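(* Let $g\ge0$, $n\ge1$ with $2g-2+n\ge2$, and let $d,d_1,\dots,d_{n-1}\ge0$ be integers with $d+\sum_{i=1}^{n-1}d_i=3g-3+n$; write $\mathbf d=\{d_1,\dots,d_{n-1}\}$. Comparing the coefficients of the top-degree monomial $b^{2d}\prod_{i=1}^{n-1}b_i^{2d_i}$ on the two sides of the recursion (N) for Weil–Petersson volumes (see context) gives the Dijkgraaf–Verlinde–Verlinde identity $$(2d+1)!!\,\langle\tau_d,\tau_{\mathbf d}\rangle_g=\frac12\sum_{\mu+\nu=d-2}(2\mu+1)!!(2\nu+1)!!\,\langle\tau_\mu,\tau_\nu,\tau_{\mathbf d}\rangle_{g-1}+\frac12\sum_{\substack{g_1+g_2=g\\ \mathbf d_1\sqcup\mathbf d_2=\mathbf d}}(2\mu+1)!!(2\nu+1)!!\,\langle\tau_\mu,\tau_{\mathbf d_1}\rangle_{g_1}\langle\tau_\nu,\tau_{\mathbf d_2}\rangle_{g_2}+\sum_{j=1}^{n-1}\frac{(2d+2d_j-1)!!}{(2d_j-1)!!}\,\langle\tau_{d+d_j-1},\tau_{\mathbf d\setminus d_j}\rangle_g,$$ where in the second sum $\mu,\nu\ge 0$ are determined by $\mu+\sum_{d_i\in\mathbf d_1}d_i=3g_1-3+n_1$ and $\nu+\sum_{d_i\in\mathbf d_2}d_i=3g_2-3+n_2$. In particular this identity holds.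
   Context: For $\sum_{i=1}^n d_i=3g-3+n$, $\langle\tau_{d_1},\dots,\tau_{d_n}\rangle_g=\int_{\overline{\mathcal M}_{g,n}}\prod_{i=1}^n\psi_i^{d_i}$, where $\psi_i$ is the first Chern class of the $i$-th tautological (cotangent) line bundle on the Deligne–Mumford space; $\tau_{\mathbf d}$ abbreviates $\tau_{d_1},\dots,\tau_{d_{n-1}}$. The Weil–Petersson volume (of the moduli space of genus $g$ hyperbolic surfaces with $n$ labelled geodesic boundaries of lengths $b_i$; $V_{1,1}$ is half of the volume) satisfies the known formula $V_{g,n}(\mathbf b)=\int_{\overline{\mathcal M}_{g,n}}\exp(2\pi^2\kappa_1+\frac12\sum b_i^2\psi_i)$, with $\kappa_1$ the first Mumford class; so $V_{g,n}$ is an even symmetric polynomial of degree $2(3g-3+n)$ whose coefficient at $\prod b_i^{2d_i}$ with $\sum d_i=3g-3+n$ is $\langle\tau_{d_1},\dots,\tau_{d_n}\rangle_g/\prod(2d_i)!!$. The recursion (N), for $\mathbf b=(b_1,\dots,b_{n-1})$ and $2g-2+n\ge2$, is $$\frac{1}{4\pi i}\Big((b+2\pi i)V_{g,n}(b+2\pi i,\mathbf b)-(b-2\pi i)V_{g,n}(b-2\pi i,\mathbf b)\Big)=\frac12\iint_{b',b''\ge 0,\ b'+b''\le b} b'b''V_{g-1,n+1}(b',b'',\mathbf b)\,db'db''+\frac12\sum_{\substack{g_1+g_2=g\\ \mathbf b_1\sqcup\mathbf b_2=\mathbf b}}\iint_{b',b''\ge 0,\ b'+b''\le b} b'b''V_{g_1,n_1}(b',\mathbf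 b_1)V_{g_2,n_2}(b'',\mathbf b_2)\,db'db''+\frac12\sum_{j=1}^{n-1}\Big(\int_0^{b+b_j}+\int_0^{b-b_j}\Big)b'V_{g,n-1}(b',\mathbf b\setminus b_j)\,db'.$$ Conventions: sums over $g_1+g_2=g$ and set partitions are over ordered pairs of nonnegative integers and ordered partitions (of the labelled entries), $n_i=|\mathbf b_i|+1=|\mathbf d_i|+1$; $\mu,\nu\ge0$; terms with $g'<0$, $2g'-2+n'\le0$, or a negative index of $\tau$ are zero; $(-1)!!=0!!=1$. *)

theory Defs
  imports "HOL-Analysis.Analysis"
begin

function double_fact :: "int \<Rightarrow> nat" where
  "double_fact k = (if k \<le> 0 then 1 else nat k * double_fact (k - 2))"
  by auto
termination by (relation "Wellfounded.measure nat") auto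

declare double_fact.simps [simp del]

definition stable :: "int \<Rightarrow> nat \<Rightarrow> bool" where
  "stable g n \<longleftrightarrow> 0 \<le> g \<and> 0 < 2 * g - 2 + int n"

text \<open>
  The Deligne--Mumford spaces \<open>M(g,n)\<close> (compactified) are not available as spaces. They enter
  through the following data: the commutative \<open>\<complex>\<close>-algebra \<open>'h\<close> stands for the even-degree cohomology
  with complex coefficients of the disjoint union of all of them, that is, for the product of the
  rings of the individual \<open>M(g,n)\<close>; \<open>deg k\<close> is the part of cohomological degree \<open>2 k\<close>;
  \<open>psi g n i\<close> (with \<open>i < n\<close>) and \<open>kappa1 g n\<close> are the tautological classes of \<open>M(g,n)\<close>,
  extended by zero to the other components; \<open>integ g n\<close> is integration over \<open>M(g,n)\<close>, which has
  complex dimension \<open>3 g - 3 + n\<close>. Complex coefficients are needed because volumes are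
  evaluated at complex boundary lengths.
\<close>

locale moduli_cohomology = vector_space smul
  for smul :: "complex \<Rightarrow> 'h::comm_ring_1 \<Rightarrow> 'h" +
  fixes deg :: "nat \<Rightarrow> 'h set"
    and psi :: "int \<Rightarrow> nat \<Rightarrow> nat \<Rightarrow> 'h"
    and kappa1 :: "int \<Rightarrow> nat \<Rightarrow> 'h"
    and integ :: "int \<Rightarrow> nat \<Rightarrow> 'h \<Rightarrow> complex"
  assumes smul_mult_left: "smul c x * y = smul c (x * y)"
    and deg_subspace: "subspace (deg k)"
    and one_deg: "1 \<in> deg 0"
    and mult_deg: "x \<in> deg j \<Longrightarrow> y \<in> deg k \<Longrightarrow> x * y \<in> deg (j + k)"
    and psi_deg: "stable g n \<Longrightarrow> i < n \<Longrightarrow> psi g n i \<in> deg 1"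
    and kappa1_deg: "stable g n \<Longrightarrow> kappa1 g n \<in> deg 1"
    and integ_linear: "stable g n \<Longrightarrow> Vector_Spaces.linear smul (*) (integ g n)"
    and integ_deg: "stable g n \<Longrightarrow> x \<in> deg k \<Longrightarrow> int k \<noteq> 3 * g - 3 + int n \<Longrightarrow> integ g n x = 0"

text \<open>
  The bracket of \<open>\<tau>\<^sub>d\<close> for \<open>d\<close> in the list \<open>ds\<close>, in genus \<open>g\<close>. The number \<open>n\<close> of marked points is the
  length of \<open>ds\<close>.
\<close>

definition intersection_number ::
  "(int \<Rightarrow> nat \<Rightarrow> nat \<Rightarrow> 'h::comm_ring_1) \<Rightarrow> (int \<Rightarrow> nat \<Rightarrow> 'h \<Rightarrow> complex) \<Rightarrow> int \<Rightarrow> int list \<Rightarrow> complex"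
where
  "intersection_number psi integ g ds =
     (let n = length ds in
      if stable g n \<and> (\<forall>d\<in>set ds. 0 \<le> d)
      then integ g n (\<Prod>i<n. psi g n i ^ nat (ds ! i)) else 0)"

text \<open>
  Exponential of a class of cohomological degree 2 on \<open>M(g,n)\<close>; its powers beyond the complex
  dimension vanish there.
\<close>

definition exp_class :: "(complex \<Rightarrow> 'h::comm_ring_1 \<Rightarrow> 'h) \<Rightarrow> int \<Rightarrow> nat \<Rightarrow> 'h \<Rightarrow> 'h" where
  "exp_class smul g n x = (\<Sum>k\<le>nat (3 * g - 3 + int n). smul (1 / fact k) (x ^ k))"

text \<open>
  \<open>V g bs\<close> is the Weil--Petersson volume \<open>V(g,n)\<close>, \<open>n\<close> being the length of \<open>bs\<close>, as a polynomial
  function of complex boundary lengths. It is tied to intersection theory by Mirzakhani's formula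
  and is zero for unstable \<open>(g,n)\<close>.
\<close>

definition volume_formula ::
  "(complex \<Rightarrow> 'h::comm_ring_1 \<Rightarrow> 'h) \<Rightarrow> (int \<Rightarrow> nat \<Rightarrow> nat \<Rightarrow> 'h) \<Rightarrow> (int \<Rightarrow> nat \<Rightarrow> 'h)
   \<Rightarrow> (int \<Rightarrow> nat \<Rightarrow> 'h \<Rightarrow> complex) \<Rightarrow> (int \<Rightarrow> complex list \<Rightarrow> complex) \<Rightarrow> bool"
where
  "volume_formula smul psi kappa1 integ V \<longleftrightarrow>
     (\<forall>g bs. let n = length bs in
        V g bs =
          (if stable g n
           then integ g n (exp_class smul g n
                  (smul (2 * complex_of_real pi ^ 2) (kappa1 g n)
                   + smul (1 / 2) (\<Sum>i<n. smul ((bs ! i) ^ 2) (psi g n i))))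
           else 0))"

definition recursion_lhs :: "(int \<Rightarrow> complex list \<Rightarrow> complex) \<Rightarrow> int \<Rightarrow> real \<Rightarrow> real list \<Rightarrow> complex" where
  "recursion_lhs V g b bs =
     (let c = 2 * complex_of_real pi * \<i>; bs' = map complex_of_real bs in
      1 / (4 * complex_of_real pi * \<i>) *
        ((of_real b + c) * V g ((of_real b + c) # bs')
         - (of_real b - c) * V g ((of_real b - c) # bs')))"

text \<open>
  The ordered partitions of the entries of \<open>bs\<close> are indexed by the set \<open>I\<close> of the positions in
  the first part. The single integrals are oriented: the upper limit \<open>b - bs ! j\<close> may be negative.
\<close>

definition recursion_rhs :: "(int \<Rightarrow> complex list \<Rightarrow> complex) \<Rightarrow> int \<Rightarrow> real \<Rightarrow> real list \<Rightarrow> complex" where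
  "recursion_rhs V g b bs =
     (let T = {p :: real \<times> real. 0 \<le> fst p \<and> 0 \<le> snd p \<and> fst p + snd p \<le> b};
          bs' = map complex_of_real bs in
      1 / 2 * (LINT p:T|lborel. of_real (fst p) * of_real (snd p)
                 * V (g - 1) (of_real (fst p) # of_real (snd p) # bs'))
      + 1 / 2 * (\<Sum>(g1, g2) \<in> {(g1, g2). 0 \<le> g1 \<and> 0 \<le> g2 \<and> g1 + g2 = g}. \<Sum>I \<in> Pow {..<length bs}.
          (LINT p:T|lborel. of_real (fst p) * of_real (snd p)
             * V g1 (of_real (fst p) # nths bs' I) * V g2 (of_real (snd p) # nths bs' (- I))))
      + 1 / 2 * (\<Sum>j<length bs.
          (LBINT x=ereal 0..ereal (b + bs ! j). of_real x * V g (of_real x # nths bs' (- {j})))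
          + (LBINT x=ereal 0..ereal (b - bs ! j). of_real x * V g (of_real x # nths bs' (- {j})))))"

definition volume_recursion :: "(int \<Rightarrow> complex list \<Rightarrow> complex) \<Rightarrow> int \<Rightarrow> nat \<Rightarrow> bool" where
  "volume_recursion V g n \<longleftrightarrow>
     (\<forall>b bs. 0 \<le> b \<and> length bs = n - 1 \<and> (\<forall>x\<in>set bs. 0 \<le> x)
        \<longrightarrow> recursion_lhs V g b bs = recursion_rhs V g b bs)"

text \<open>
  On nonnegative arguments, \<open>f\<close> is a polynomial function in \<open>b, bs\<close> (\<open>n\<close> variables in total) of
  total degree at most \<open>D\<close>, the coefficient of the monomial with exponent list \<open>\<alpha>\<close> being \<open>C \<alpha>\<close>.
  The domain is the orthant because the triangle of integration degenerates for negative \<open>b\<close>; the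
  orthant is Zariski dense, so that \<open>C\<close> is determined by \<open>f\<close>.
\<close>

definition has_coefficients ::
  "nat \<Rightarrow> int \<Rightarrow> (real \<Rightarrow> real list \<Rightarrow> complex) \<Rightarrow> (nat list \<Rightarrow> complex) \<Rightarrow> bool"
where
  "has_coefficients n D f C \<longleftrightarrow>
     finite {\<alpha>. C \<alpha> \<noteq> 0} \<and>
     (\<forall>\<alpha>. C \<alpha> \<noteq> 0 \<longrightarrow> length \<alpha> = n \<and> int (sum_list \<alpha>) \<le> D) \<and>
     (\<forall>b bs. length (b # bs) = n \<and> (\<forall>x\<in>set (b # bs). 0 \<le> x) \<longrightarrow>
        f b bs = (\<Sum>\<alpha> | C \<alpha> \<noteq> 0. C \<alpha> * (\<Prod>i<n. of_real ((b # bs) ! i) ^ (\<alpha> ! i))))"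

end

(*
  By the volume formula V is a polynomial in the squares of the lengths, whose coefficients of top
  degree are the brackets divided by products of double factorials. Both sides of the recursion
  are therefore finite sums of explicit monomials: (b + c)^m - (b - c)^m and (b + y)^m + (b - y)^m
  expand binomially, and x^p y^q integrates over the triangle x + y <= b to
  p! q! / (p + q + 2)! b^(p + q + 2). Only top coefficients of the volumes contribute to the top
  degree: the degree bounds of the volumes involved add up to exactly the degree of the monomial,
  so each bound has to be attained. A polynomial is determined by its values on the orthant, which
  turns the recursion into equality of the coefficients.
*)

theory Submission
  imports Defs
begin

section \<open>Polynomials on the orthant\<close>

text \<open>Each term of the recursion is written as a finite sum of scalars \<open>a s\<close>
  times monomials with exponent list \<open>\<delta> s\<close>, where \<open>\<delta>\<close> may
  repeat values; the wanted coefficient is the sum over a fibre of \<open>\<delta>\<close>. In the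
  separating term the exponents of the two volumes sit at complementary positions;
  \<open>merge\<close> carries them back to one exponent list. The double factorials come from the
  normalisation. A top coefficient carries 1/(2k)!! for each exponent k, and (2k+1)!/(2k)!! =
  (2k+1)!!. The left side gives (2d+1)/(2d)!! = (2d+1)!!/(2d)!, and the triangle integrals also
  leave 1/(2d)!. In the boundary terms the binomial coefficient brings 1/((2d)! (2d_j)!), where
  (2d_j)! = (2d_j)!! (2d_j-1)!!. So all terms share the denominator (2d)! times the product of the
  (2d_i)!!, and the numerators form the identity.\<close>

definition monom_eval :: "nat list \<Rightarrow> 'a::comm_monoid_mult list \<Rightarrow> 'a" where
  "monom_eval \<alpha> xs = prod_list (map2 (\<lambda>x k. x ^ k) xs \<alpha>)"

lemma monom_eval_Cons [simp]: "monom_eval (k # \<alpha>) (x # xs) = x ^ k * monom_eval \<alpha> xs"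
  and monom_eval_Nil [simp]: "monom_eval [] xs = 1" "monom_eval \<alpha> [] = 1"
  by (simp_all add: monom_eval_def)

text \<open>Links the zipped product, which suits induction on lists and splitting by
  \<open>nths\<close>, to the indexed product in \<open>has_coefficients\<close>.\<close>

lemma monom_eval_conv_prod:
  "length xs = length \<alpha> \<Longrightarrow> monom_eval \<alpha> xs = (\<Prod>i<length \<alpha>. xs ! i ^ (\<alpha> ! i))"
  by (induction xs \<alpha> rule: list_induct2) (simp_all add: prod.lessThan_Suc_shift del: prod.lessThan_Suc)

text \<open>Records a single coefficient and hides the rest of the coefficient function, so that
  terms can be added one by one. The bound \<open>D\<close> is shared by all terms; uniqueness is
  supplied separately by \<open>has_coefficients_unique\<close>.\<close>

definition has_coefficient ::
  "nat \<Rightarrow> int \<Rightarrow> (real \<Rightarrow> real list \<Rightarrow> complex) \<Rightarrow> nat list \<Rightarrow> complex \<Rightarrow> bool" where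
  "has_coefficient n D f \<alpha> c \<longleftrightarrow> (\<exists>C. has_coefficients n D f C \<and> C \<alpha> = c)"

text \<open>Summing over any finite superset of the support allows two polynomials to be written
  over one index set.\<close>

lemma has_coefficients_expansion:
  assumes "has_coefficients n D f C" "finite A" "{\<alpha>. C \<alpha> \<noteq> 0} \<subseteq> A" "\<And>\<alpha>. \<alpha> \<in> A \<Longrightarrow> length \<alpha> = n"
    and "length (b # bs) = n" "\<forall>x\<in>set (b # bs). 0 \<le> x"
  shows "f b bs = (\<Sum>\<alpha>\<in>A. C \<alpha> * monom_eval \<alpha> (map of_real (b # bs)))"
proof -
  have "f b bs = (\<Sum>\<alpha> | C \<alpha> \<noteq> 0. C \<alpha> * (\<Prod>i<n. of_real ((b # bs) ! i) ^ (\<alpha> ! i)))"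
    using assms(1,5,6) unfolding has_coefficients_def by blast
  also have "\<dots> = (\<Sum>\<alpha>\<in>A. C \<alpha> * (\<Prod>i<n. of_real ((b # bs) ! i) ^ (\<alpha> ! i)))"
    using assms(2,3) by (intro sum.mono_neutral_left) auto
  also have "\<dots> = (\<Sum>\<alpha>\<in>A. C \<alpha> * monom_eval \<alpha> (map of_real (b # bs)))"
  proof (intro sum.cong refl arg_cong2[where f = "(*)"])
    fix \<alpha> assume "\<alpha> \<in> A"
    then have n: "length \<alpha> = n" using assms(4) by blast
    show "(\<Prod>i<n. of_real ((b # bs) ! i) ^ (\<alpha> ! i)) = (monom_eval \<alpha> (map of_real (b # bs)) :: complex)"
      using n assms(5) by (subst monom_eval_conv_prod) (auto intro!: prod.cong simp del: list.map simp: nth_map)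
  qed
  finally show ?thesis .
qed

lemma has_coefficientsI:
  assumes "finite A" "{\<alpha>. C \<alpha> \<noteq> 0} \<subseteq> A"
    and deg: "\<And>\<alpha>. C \<alpha> \<noteq> 0 \<Longrightarrow> length \<alpha> = n \<and> int (sum_list \<alpha>) \<le> D"
    and f: "\<And>b bs. length (b # bs) = n \<Longrightarrow> \<forall>x\<in>set (b # bs). 0 \<le> x \<Longrightarrow>
        f b bs = (\<Sum>\<alpha>\<in>A. C \<alpha> * monom_eval \<alpha> (map of_real (b # bs)))"
  shows "has_coefficients n D f C"
  unfolding has_coefficients_def
proof (intro conjI allI impI)
  show "finite {\<alpha>. C \<alpha> \<noteq> 0}" using assms(1,2) finite_subset by blast
  fix b :: real and bs :: "real list" assume *: "length (b # bs) = n \<and> (\<forall>x\<in>set (b # bs). 0 \<le> x)"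
  have "f b bs = (\<Sum>\<alpha>\<in>A. C \<alpha> * monom_eval \<alpha> (map of_real (b # bs)))" using f * by blast
  also have "\<dots> = (\<Sum>\<alpha> | C \<alpha> \<noteq> 0. C \<alpha> * monom_eval \<alpha> (map of_real (b # bs)))"
    using assms(1,2) by (intro sum.mono_neutral_right) auto
  also have "\<dots> = (\<Sum>\<alpha> | C \<alpha> \<noteq> 0. C \<alpha> * (\<Prod>i<n. of_real ((b # bs) ! i) ^ (\<alpha> ! i)))"
  proof (intro sum.cong refl arg_cong2[where f = "(*)"])
    fix \<alpha> assume "\<alpha> \<in> {\<alpha>. C \<alpha> \<noteq> 0}"
    then have n: "length \<alpha> = n" using deg by blast
    show "monom_eval \<alpha> (map of_real (b # bs)) = (\<Prod>i<n. complex_of_real ((b # bs) ! i) ^ (\<alpha> ! i))"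
      using n * by (subst monom_eval_conv_prod) (auto intro!: prod.cong simp del: list.map simp: nth_map)
  qed
  finally show "f b bs = (\<Sum>\<alpha> | C \<alpha> \<noteq> 0. C \<alpha> * (\<Prod>i<n. of_real ((b # bs) ! i) ^ (\<alpha> ! i)))" .
qed (use deg in blast)+

text \<open>Equal monomials are collected along the fibres of \<open>\<delta>\<close>, which need
  not be injective. The degree bound is asked only where \<open>a s\<close> is nonzero; the left
  side of the recursion depends on this, since its formal leading terms exceed the bound and
  cancel.\<close>

lemma has_coefficient_sum_monom:
  assumes "finite S"
    and deg: "\<And>s. s \<in> S \<Longrightarrow> a s \<noteq> 0 \<Longrightarrow> length (\<delta> s) = n \<and> int (sum_list (\<delta> s)) \<le> D"
    and f: "\<And>b bs. length (b # bs) = n \<Longrightarrow> \<forall>x\<in>set (b # bs). 0 \<le> x \<Longrightarrow>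
        f b bs = (\<Sum>s\<in>S. a s * monom_eval (\<delta> s) (map of_real (b # bs)))"
  shows "has_coefficient n D f \<alpha> (\<Sum>s\<in>S. if \<delta> s = \<alpha> then a s else 0)"
  unfolding has_coefficient_def
proof (intro exI conjI)
  define C where "C = (\<lambda>\<alpha>. \<Sum>s\<in>S. if \<delta> s = \<alpha> then a s else 0)"
  show "C \<alpha> = (\<Sum>s\<in>S. if \<delta> s = \<alpha> then a s else 0)" by (simp add: C_def)
  have nz: "\<exists>s\<in>S. \<delta> s = \<alpha> \<and> a s \<noteq> 0" if "C \<alpha> \<noteq> 0" for \<alpha>
    using that sum.not_neutral_contains_not_neutral[of "\<lambda>s. if \<delta> s = \<alpha> then a s else 0" S]
    unfolding C_def by (metis (full_types))
  show "has_coefficients n D f C"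
  proof (rule has_coefficientsI)
    show "finite (\<delta> ` S)" using \<open>finite S\<close> by simp
    show "{\<alpha>. C \<alpha> \<noteq> 0} \<subseteq> \<delta> ` S" using nz by blast
    show "length \<alpha> = n \<and> int (sum_list \<alpha>) \<le> D" if "C \<alpha> \<noteq> 0" for \<alpha>
      using nz[OF that] deg by blast
    fix b :: real and bs :: "real list" assume *: "length (b # bs) = n" "\<forall>x\<in>set (b # bs). 0 \<le> x"
    let ?m = "\<lambda>\<alpha>. monom_eval \<alpha> (map complex_of_real (b # bs))"
    have "f b bs = (\<Sum>s\<in>S. a s * ?m (\<delta> s))" using f[OF *] .
    also have "\<dots> = (\<Sum>\<alpha>\<in>\<delta> ` S. \<Sum>s | s \<in> S \<and> \<delta> s = \<alpha>. a s * ?m (\<delta> s))"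
      using \<open>finite S\<close> by (rule sum.image_gen)
    also have "\<dots> = (\<Sum>\<alpha>\<in>\<delta> ` S. C \<alpha> * ?m \<alpha>)"
      proof (rule sum.cong[OF refl])
      fix \<alpha>
      have "(\<Sum>s | s \<in> S \<and> \<delta> s = \<alpha>. a s * ?m (\<delta> s))
          = (\<Sum>s | s \<in> S \<and> \<delta> s = \<alpha>. a s) * ?m \<alpha>"
        unfolding sum_distrib_right by (intro sum.cong) auto
      also have "(\<Sum>s | s \<in> S \<and> \<delta> s = \<alpha>. a s) = C \<alpha>"
        unfolding C_def using \<open>finite S\<close> by (rule sum.inter_filter)
      finally show "(\<Sum>s | s \<in> S \<and> \<delta> s = \<alpha>. a s * ?m (\<delta> s)) = C \<alpha> * ?m \<alpha>" .
    qed
    finally show "f b bs = (\<Sum>\<alpha>\<in>\<delta> ` S. C \<alpha> * ?m \<alpha>)" .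
  qed
qed

lemma has_coefficient_cong:
  assumes "has_coefficient n D f \<alpha> c"
    and "\<And>b bs. length (b # bs) = n \<Longrightarrow> \<forall>x\<in>set (b # bs). 0 \<le> x \<Longrightarrow> f' b bs = f b bs"
  shows "has_coefficient n D f' \<alpha> c"
proof -
  obtain C where C: "has_coefficients n D f C" "C \<alpha> = c"
    using assms(1) unfolding has_coefficient_def by blast
  have "has_coefficients n D f' C"
    using C(1) assms(2) unfolding has_coefficients_def by simp
  then show ?thesis using C(2) unfolding has_coefficient_def by blast
qed

lemma has_coefficient_add:
  assumes "has_coefficient n D f \<alpha> c" "has_coefficient n D f' \<alpha> c'"
  shows "has_coefficient n D (\<lambda>b bs. f b bs + f' b bs) \<alpha> (c + c')"
proof -
  obtain C C' where C: "has_coefficients n D f C" "C \<alpha> = c" "has_coefficients n D f' C'" "C' \<alpha> = c'"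
    using assms unfolding has_coefficient_def by blast
  let ?A = "{\<alpha>. C \<alpha> \<noteq> 0} \<union> {\<alpha>. C' \<alpha> \<noteq> 0}"
  have fin: "finite ?A" and len: "\<And>\<beta>. \<beta> \<in> ?A \<Longrightarrow> length \<beta> = n \<and> int (sum_list \<beta>) \<le> D"
    using C unfolding has_coefficients_def by auto
  have "has_coefficients n D (\<lambda>b bs. f b bs + f' b bs) (\<lambda>\<alpha>. C \<alpha> + C' \<alpha>)"
  proof (rule has_coefficientsI[OF fin])
    show "length \<beta> = n \<and> int (sum_list \<beta>) \<le> D" if "C \<beta> + C' \<beta> \<noteq> 0" for \<beta>
      using that by (intro len) auto
    fix b :: real and bs :: "real list" assume *: "length (b # bs) = n" "\<forall>x\<in>set (b # bs). 0 \<le> x"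
    show "f b bs + f' b bs
      = (\<Sum>\<alpha>\<in>?A. (C \<alpha> + C' \<alpha>) * monom_eval \<alpha> (map of_real (b # bs)))"
      using has_coefficients_expansion[OF C(1) fin _ _ *] has_coefficients_expansion[OF C(3) fin _ _ *] len
      by (simp add: distrib_right sum.distrib)
  qed auto
  then show ?thesis using C unfolding has_coefficient_def by blast
qed

lemma has_coefficient_zero: "has_coefficient n D (\<lambda>b bs. 0) \<alpha> 0"
  using has_coefficient_sum_monom[of "{}::unit set" "\<lambda>_. 0" "\<lambda>_. []" n D "\<lambda>b bs. 0" \<alpha>] by simp

lemma has_coefficient_sum:
  assumes "\<And>i. i \<in> A \<Longrightarrow> has_coefficient n D (f i) \<alpha> (c i)"
  shows "has_coefficient n D (\<lambda>b bs. \<Sum>i\<in>A. f i b bs) \<alpha> (\<Sum>i\<in>A. c i)"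
  using assms by (induction A rule: infinite_finite_induct)
    (auto intro: has_coefficient_zero has_coefficient_add)

lemma has_coefficient_cmult:
  assumes "has_coefficient n D f \<alpha> c"
  shows "has_coefficient n D (\<lambda>b bs. k * f b bs) \<alpha> (k * c)"
proof -
  obtain C where C: "has_coefficients n D f C" "C \<alpha> = c"
    using assms unfolding has_coefficient_def by blast
  let ?A = "{\<alpha>. C \<alpha> \<noteq> 0}"
  have fin: "finite ?A" and len: "\<And>\<beta>. \<beta> \<in> ?A \<Longrightarrow> length \<beta> = n \<and> int (sum_list \<beta>) \<le> D"
    using C unfolding has_coefficients_def by auto
  have "has_coefficients n D (\<lambda>b bs. k * f b bs) (\<lambda>\<alpha>. k * C \<alpha>)"
  proof (rule has_coefficientsI[OF fin])
    fix b :: real and bs :: "real list" assume *: "length (b # bs) = n" "\<forall>x\<in>set (b # bs). 0 \<le> x"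
    show "k * f b bs = (\<Sum>\<alpha>\<in>?A. (k * C \<alpha>) * monom_eval \<alpha> (map of_real (b # bs)))"
      using has_coefficients_expansion[OF C(1) fin _ _ *] len
      by (simp add: sum_distrib_left mult.assoc)
  qed (use len in auto)
  then show ?thesis using C unfolding has_coefficient_def by blast
qed

text \<open>Induction on the number of variables: for fixed remaining variables the sum is a
  polynomial in the first one that vanishes on a half-line, so all its coefficients vanish, and
  these are polynomials in fewer variables.\<close>

lemma polynomial_zero_on_orthant:
  fixes C :: "nat list \<Rightarrow> complex"
  assumes "finite A" "\<And>\<alpha>. \<alpha> \<in> A \<Longrightarrow> length \<alpha> = n"
    and "\<And>xs. length xs = n \<Longrightarrow> \<forall>x\<in>set xs. 0 \<le> x \<Longrightarrow>
      (\<Sum>\<alpha>\<in>A. C \<alpha> * monom_eval \<alpha> (map of_real xs)) = 0"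
    and "\<alpha> \<in> A"
  shows "C \<alpha> = 0"
  using assms
proof (induction n arbitrary: A C \<alpha>)
  case 0
  have "A = {[]}" using 0 by auto
  then show ?case using 0(3)[of "[]"] 0(4) by simp
next
  case (Suc n)
  \<comment> \<open>\<open>B k\<close> is the slice of \<open>A\<close> with first exponent
    \<open>k\<close>. It may be empty, which lets \<open>k\<close> range over the whole segment up
    to the largest first exponent \<open>m\<close>, as the theorem on polynomial roots
    requires.\<close>
  define B where "B k = {\<beta>. k # \<beta> \<in> A}" for k
  have inj: "inj (\<lambda>\<beta>::nat list. k # \<beta>)" for k by (simp add: inj_def)
  have Bvim: "B k = (\<lambda>\<beta>. k # \<beta>) -` A" for k by (auto simp: B_def)
  have finB: "finite (B k)" for k
    unfolding Bvim by (rule finite_vimageI[OF \<open>finite A\<close> inj])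
  define m where "m = Max (hd ` A)"
  have m: "hd \<beta> \<le> m" if "\<beta> \<in> A" for \<beta> using that \<open>finite A\<close> by (simp add: m_def)
  define P where "P xs k = (\<Sum>\<beta>\<in>B k. C (k # \<beta>) * monom_eval \<beta> (map of_real xs))"
    for xs :: "real list" and k
  have A_eq: "A = (\<lambda>(k, \<beta>). k # \<beta>) ` (SIGMA k:{..m}. B k)"
  proof (intro set_eqI iffI)
    fix \<beta> assume "\<beta> \<in> A"
    moreover from this Suc.prems(2) obtain k \<gamma> where "\<beta> = k # \<gamma>" by (cases \<beta>) force+
    ultimately show "\<beta> \<in> (\<lambda>(k, \<beta>). k # \<beta>) ` (SIGMA k:{..m}. B k)"
      using m by (force simp: B_def)
  qed (auto simp: B_def)
  have expand: "(\<Sum>\<alpha>\<in>A. C \<alpha> * monom_eval \<alpha> (map of_real (x # xs))) = (\<Sum>k\<le>m. P xs k * of_real x ^ k)"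
    for x xs
  proof -
    have "(\<Sum>\<alpha>\<in>A. C \<alpha> * monom_eval \<alpha> (map of_real (x # xs)))
        = (\<Sum>(k, \<beta>)\<in>(SIGMA k:{..m}. B k). C (k # \<beta>) * (of_real x ^ k * monom_eval \<beta> (map of_real xs)))"
      by (subst A_eq, subst sum.reindex) (auto simp: inj_on_def case_prod_beta intro!: sum.cong)
    also have "\<dots> = (\<Sum>k\<le>m. P xs k * of_real x ^ k)"
      by (subst sum.Sigma[symmetric]) (auto simp: finB P_def sum_distrib_left mult_ac)
    finally show ?thesis .
  qed
  have P0: "P xs k = 0" if xs: "length xs = n" "\<forall>x\<in>set xs. 0 \<le> x" and k: "k \<le> m" for xs k
  proof (rule ccontr)
    assume "P xs k \<noteq> 0"
    \<comment> \<open>A complex polynomial with a nonzero coefficient has finitely many roots,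
      whereas the whole nonnegative half-line consists of roots.\<close>
    then have "finite {z. (\<Sum>i\<le>m. P xs i * z ^ i) = 0}"
      using k by (intro iffD2[OF polyfun_finite_roots]) auto
    moreover have "of_real ` {0::real..} \<subseteq> {z. (\<Sum>i\<le>m. P xs i * z ^ i) = 0}"
    proof clarify
      fix x :: real assume "x \<ge> 0"
      then show "(\<Sum>i\<le>m. P xs i * of_real x ^ i) = 0"
        using Suc.prems(3)[of "x # xs"] xs by (simp only: expand) simp
    qed
    ultimately have "finite (complex_of_real ` {0::real..})" by (rule rev_finite_subset)
    then show False
      by (subst (asm) finite_image_iff) (auto simp: inj_on_def infinite_Ici)
  qed
  obtain k \<beta> where \<alpha>: "\<alpha> = k # \<beta>" using Suc.prems(2)[OF Suc.prems(4)] by (cases \<alpha>) auto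
  have "C (k # \<beta>) = 0"
  proof (rule Suc.IH[of "B k" "\<lambda>\<beta>. C (k # \<beta>)"])
    show "length \<gamma> = n" if "\<gamma> \<in> B k" for \<gamma> using that Suc.prems(2) by (force simp: B_def)
    show "(\<Sum>\<beta>\<in>B k. C (k # \<beta>) * monom_eval \<beta> (map of_real xs)) = 0"
      if "length xs = n" "\<forall>x\<in>set xs. 0 \<le> x" for xs
      using P0[OF that, of k] m[OF Suc.prems(4)] \<alpha> by (simp add: P_def)
    show "\<beta> \<in> B k" using \<alpha> Suc.prems(4) by (simp add: B_def)
  qed (rule finB)
  then show ?case by (simp add: \<alpha>)
qed

text \<open>The difference of the two polynomials vanishes on the orthant. With \<open>n = 0\<close>
  the equality of values would be vacuous, because the first variable is split off.\<close>

lemma has_coefficients_unique: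
  assumes C: "has_coefficients n D f C" and C': "has_coefficients n D f' C'" and "n \<ge> 1"
    and eq: "\<And>b bs. length (b # bs) = n \<Longrightarrow> \<forall>x\<in>set (b # bs). 0 \<le> x \<Longrightarrow> f b bs = f' b bs"
  shows "C = C'"
proof
  fix \<alpha>
  let ?A = "{\<alpha>. C \<alpha> \<noteq> 0} \<union> {\<alpha>. C' \<alpha> \<noteq> 0}"
  have fin: "finite ?A" and len: "\<And>\<beta>. \<beta> \<in> ?A \<Longrightarrow> length \<beta> = n"
    using C C' unfolding has_coefficients_def by auto
  have "C \<alpha> - C' \<alpha> = 0" if "\<alpha> \<in> ?A"
  proof (rule polynomial_zero_on_orthant[OF fin len _ that])
    fix xs :: "real list" assume xs: "length xs = n" "\<forall>x\<in>set xs. 0 \<le> x"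
    then obtain b bs where [simp]: "xs = b # bs" using \<open>n \<ge> 1\<close> by (cases xs) auto
    have *: "length (b # bs) = n" "\<forall>x\<in>set (b # bs). 0 \<le> x" using xs by auto
    show "(\<Sum>\<alpha>\<in>?A. (C \<alpha> - C' \<alpha>) * monom_eval \<alpha> (map of_real xs)) = 0"
      using has_coefficients_expansion[OF C fin _ len *] has_coefficients_expansion[OF C' fin _ len *] eq[OF *]
      by (simp add: left_diff_distrib sum_subtractf)
  qed
  then show "C \<alpha> = C' \<alpha>" by (cases "\<alpha> \<in> ?A") auto
qed

section \<open>Splitting a list along a set of positions and reassembling it\<close>

lemma nths_zip: "nths (zip xs ys) I = zip (nths xs I) (nths ys I)"
proof (induction xs arbitrary: ys I)
  case (Cons x xs)
  then show ?case by (cases ys) (auto simp: nths_Cons)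
qed simp

text \<open>\<open>nths_Cons\<close> shifts the position set; the shift commutes with complements,
  so one induction hypothesis serves both halves.\<close>

lemma shift_Compl: "{j. Suc j \<in> - I} = - {j. Suc j \<in> I}"
  by auto

lemma prod_list_nths_Compl:
  fixes f :: "'a \<Rightarrow> 'b::comm_monoid_mult"
  shows "prod_list (map f xs) = prod_list (map f (nths xs I)) * prod_list (map f (nths xs (- I)))"
proof (induction xs arbitrary: I)
  case (Cons x xs)
  show ?case by (subst (1 2) nths_Cons)
     (auto simp: shift_Compl Cons.IH[of "{j. Suc j \<in> I}"] mult_ac simp flip: Collect_neg_eq)
qed simp

lemma sum_list_nths_Compl:
  fixes xs :: "'a::comm_monoid_add list"
  shows "sum_list xs = sum_list (nths xs I) + sum_list (nths xs (- I))"
proof (induction xs arbitrary: I)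
  case (Cons x xs)
  show ?case by (subst (1 2) nths_Cons)
     (auto simp: shift_Compl Cons.IH[of "{j. Suc j \<in> I}"] add_ac simp flip: Collect_neg_eq)
qed simp

lemma monom_eval_nths_Compl:
  "monom_eval \<alpha> xs = monom_eval (nths \<alpha> I) (nths xs I) * monom_eval (nths \<alpha> (- I)) (nths xs (- I))"
  unfolding monom_eval_def nths_zip[symmetric] by (rule prod_list_nths_Compl)

text \<open>Inverse to splitting a list of length \<open>m\<close> into its parts at
  \<open>I\<close> and at \<open>- I\<close>. The result has length \<open>m\<close> whatever the
  arguments, so the lengths of the parts must be assumed wherever the parts are to be
  recovered.\<close>

fun merge :: "nat set \<Rightarrow> nat \<Rightarrow> 'a list \<Rightarrow> 'a list \<Rightarrow> 'a list" where
  "merge I 0 xs ys = []"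
| "merge I (Suc m) xs ys =
    (if 0 \<in> I then hd xs # merge {j. Suc j \<in> I} m (tl xs) ys
     else hd ys # merge {j. Suc j \<in> I} m xs (tl ys))"

lemma length_merge [simp]: "length (merge I m xs ys) = m"
  by (induction m arbitrary: I xs ys) auto

lemma merge_nths: "merge I (length zs) (nths zs I) (nths zs (- I)) = zs"
proof (induction zs arbitrary: I)
  case (Cons z zs)
  show ?case using Cons.IH[of "{j. Suc j \<in> I}"] by (auto simp: nths_Cons shift_Compl simp flip: Collect_neg_eq)
qed simp

text \<open>\<open>zs\<close> is a template for the lengths, which avoids counting the positions of
  \<open>I\<close> below the total length.\<close>

lemma nths_merge:
  assumes "length xs = length (nths zs I)" "length ys = length (nths zs (- I))"
  shows "nths (merge I (length zs) xs ys) I = xs" "nths (merge I (length zs) xs ys) (- I) = ys"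
  using assms
proof (induction zs arbitrary: I xs ys)
  case (Cons z zs)
  {
    case 1
    then show ?case using Cons.IH[of "tl xs" "{j. Suc j \<in> I}" ys] Cons.IH[of xs "{j. Suc j \<in> I}" "tl ys"]
      by (cases xs; cases ys; auto simp: nths_Cons shift_Compl simp flip: Collect_neg_eq split: if_splits)
  next
    case 2
    then show ?case using Cons.IH[of "tl xs" "{j. Suc j \<in> I}" ys] Cons.IH[of xs "{j. Suc j \<in> I}" "tl ys"]
      by (cases xs; cases ys; auto simp: nths_Cons shift_Compl simp flip: Collect_neg_eq split: if_splits)
  }
qed simp_all

section \<open>Integrals of monomials\<close>

text \<open>The beta integral, by integration by parts: one step lowers the exponent of
  \<open>b - x\<close> and raises that of \<open>x\<close>, hence the induction on \<open>q\<close>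
  with \<open>p\<close> arbitrary.\<close>

lemma has_integral_beta_nat:
  fixes b :: real
  assumes "0 \<le> b"
  shows "((\<lambda>x. x ^ p * (b - x) ^ q) has_integral
           (fact p * fact q / fact (p + q + 1) * b ^ (p + q + 1))) {0..b}"
proof (induction q arbitrary: p)
  case 0
  have "((\<lambda>x. x ^ p) has_integral (b ^ Suc p / Suc p - 0 ^ Suc p / Suc p)) {0..b}"
  proof (rule fundamental_theorem_of_calculus[OF assms])
    fix x
    show "((\<lambda>x. x ^ Suc p / Suc p) has_vector_derivative x ^ p) (at x within {0..b})"
      using DERIV_cdivide[OF DERIV_pow[of "Suc p" x "{0..b}"], of "real (Suc p)"]
      by (simp add: has_real_derivative_iff_has_vector_derivative[symmetric] del: of_nat_Suc)
  qed
  then show ?case by (simp del: of_nat_Suc)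
next
  case (Suc q)
  let ?I = "fact (Suc p) * fact q / fact (Suc p + q + 1) * b ^ (Suc p + q + 1)"
  \<comment> \<open>The integrand is the derivative of \<open>x ^ Suc p * (b - x) ^ Suc q\<close>,
    which vanishes at both ends, so this integral is zero; adding \<open>q + 1\<close> times the
    induction hypothesis isolates the wanted integrand.\<close>
  have "((\<lambda>x. (p + 1) * x ^ p * (b - x) ^ Suc q - (q + 1) * (x ^ Suc p * (b - x) ^ q)) has_integral
          (b ^ Suc p * (b - b) ^ Suc q - 0 ^ Suc p * (b - 0) ^ Suc q)) {0..b}"
  proof (rule fundamental_theorem_of_calculus[OF assms])
    fix x
    have "((\<lambda>x. (b - x) ^ Suc q) has_field_derivative - (real (Suc q) * (b - x) ^ q)) (at x within {0..b})"
      using DERIV_power[OF DERIV_diff[OF DERIV_const DERIV_ident], where n = "Suc q"]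
      by (simp del: of_nat_Suc power_Suc)
    from DERIV_mult[OF DERIV_pow[of "Suc p" x "{0..b}"] this]
    show "((\<lambda>x. x ^ Suc p * (b - x) ^ Suc q) has_vector_derivative
        (p + 1) * x ^ p * (b - x) ^ Suc q - (q + 1) * (x ^ Suc p * (b - x) ^ q)) (at x within {0..b})"
      by (simp add: has_real_derivative_iff_has_vector_derivative[symmetric] mult_ac del: power_Suc)
  qed
  from has_integral_add[OF this has_integral_mult_right[OF Suc.IH[of "Suc p"], of "real (q + 1)"]]
  have "((\<lambda>x. (p + 1) * (x ^ p * (b - x) ^ Suc q)) has_integral (q + 1) * ?I) {0..b}"
    by (simp add: mult.assoc)
  from has_integral_mult_right[OF this, of "1 / (p + 1)"]
  have "((\<lambda>x. x ^ p * (b - x) ^ Suc q) has_integral 1 / (p + 1) * ((q + 1) * ?I)) {0..b}"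
    by (simp del: of_nat_add of_nat_Suc power_Suc fact_Suc)
  moreover have "1 / real (p + 1) * (real (q + 1) * ?I)
      = fact p * fact (Suc q) / fact (p + Suc q + 1) * b ^ (p + Suc q + 1)"
    by (simp add: field_simps del: of_nat_Suc of_nat_add)
  ultimately show ?case by (simp add: mult_ac)
qed

definition triangle :: "real \<Rightarrow> (real \<times> real) set" where
  "triangle b = {p. 0 \<le> fst p \<and> 0 \<le> snd p \<and> fst p + snd p \<le> b}"

lemma compact_triangle: "compact (triangle b)"
proof -
  have "closed (triangle b)"
    unfolding triangle_def by (intro closed_Collect_conj closed_Collect_le continuous_intros)
  moreover have "triangle b \<subseteq> cbox (0, 0) (b, b)"
    by (auto simp: triangle_def cbox_Pair_eq)
  ultimately show ?thesis
    using compact_cbox closed_Int_compact by (metis inf.absorb1)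
qed

text \<open>Compactness turns continuity into integrability, which Fubini and the interchange with
  finite sums require.\<close>

lemma set_integrable_triangle:
  fixes f :: "real \<times> real \<Rightarrow> 'a::{banach, second_countable_topology}"
  assumes "continuous_on (triangle b) f"
  shows "set_integrable lborel (triangle b) f"
  using borel_integrable_compact[OF compact_triangle assms]
  by (simp add: set_integrable_def indicator_scaleR_eq_if)

text \<open>By Fubini the inner integral over \<open>y\<close> is
  \<open>(b - x) ^ (q + 1) / (q + 1)\<close>; what remains is a beta integral, whose
  \<open>(q + 1)!\<close> absorbs the division.\<close>

lemma integral_triangle_monom:
  assumes "0 \<le> b"
  shows "(LINT z:triangle b|lborel. fst z ^ p * snd z ^ q)
    = fact p * fact q / fact (p + q + 2) * b ^ (p + q + 2)"
proof -
  let ?f = "\<lambda>z. indicator (triangle b) z *\<^sub>R (fst z ^ p * snd z ^ q)"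
  have int: "integrable (lborel \<Otimes>\<^sub>M lborel) ?f"
    unfolding lborel_prod set_integrable_def[symmetric]
    by (intro set_integrable_triangle continuous_intros)
  have inner: "(LINT y|lborel. ?f (x, y))
      = indicator {0..b} x *\<^sub>R (1 / (q + 1) * (x ^ p * (b - x) ^ (q + 1)))" for x
  proof (cases "x \<in> {0..b}")
    case True
    have "(LINT y|lborel. ?f (x, y)) = (LINT y|lborel. x ^ p * (indicator {0..b-x} y *\<^sub>R y ^ q))"
      using True by (intro Bochner_Integration.integral_cong) (auto simp: triangle_def indicator_def)
    also have "\<dots> = x ^ p * (LINT y|lborel. indicator {0..b-x} y *\<^sub>R y ^ q)"
      by (rule Bochner_Integration.integral_mult_right_zero)
    also have "(LINT y|lborel. indicator {0..b-x} y *\<^sub>R y ^ q) = (b - x) ^ Suc q / Suc q"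
      using True integral_power[of 0 "b - x" q] by (simp add: mult.commute)
    finally show ?thesis using True by simp
  next
    case False
    then have "(x, y) \<notin> triangle b" for y by (auto simp: triangle_def)
    then show ?thesis using False by simp
  qed
  have "(LINT z:triangle b|lborel. fst z ^ p * snd z ^ q) = integral\<^sup>L (lborel \<Otimes>\<^sub>M lborel) ?f"
    by (simp add: set_lebesgue_integral_def lborel_prod)
  also have "\<dots> = (LINT x|lborel. LINT y|lborel. ?f (x, y))"
    by (rule lborel_pair.integral_fst'[OF int, symmetric])
  also have "\<dots> = (LINT x:{0..b}|lborel. 1 / (q + 1) * (x ^ p * (b - x) ^ (q + 1)))"
    unfolding inner set_lebesgue_integral_def ..
  also have "\<dots> = integral {0..b} (\<lambda>x. 1 / (q + 1) * (x ^ p * (b - x) ^ (q + 1)))"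
    by (intro set_borel_integral_eq_integral(2) borel_integrable_atLeastAtMost' continuous_intros)
  also have "\<dots> = 1 / (q + 1) * (fact p * fact (q + 1) / fact (p + (q + 1) + 1) * b ^ (p + (q + 1) + 1))"
    by (intro integral_unique has_integral_mult_right has_integral_beta_nat assms)
  also have "\<dots> = fact p * fact q / fact (p + q + 2) * b ^ (p + q + 2)"
    by (simp add: field_simps del: of_nat_Suc of_nat_add)
  finally show ?thesis .
qed

lemma integral_triangle_sum:
  fixes a :: "'s \<Rightarrow> complex"
  assumes "0 \<le> b" "finite S"
  shows "(LINT z:triangle b|lborel. (\<Sum>s\<in>S. a s * (of_real (fst z) ^ p s * of_real (snd z) ^ q s)))
    = (\<Sum>s\<in>S. a s * (fact (p s) * fact (q s) / fact (p s + q s + 2)) * of_real b ^ (p s + q s + 2))"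
proof -
  have "(LINT z:triangle b|lborel. (\<Sum>s\<in>S. a s * (of_real (fst z) ^ p s * of_real (snd z) ^ q s)))
      = (LINT z|lborel. (\<Sum>s\<in>S. indicator (triangle b) z *\<^sub>R (a s * of_real (fst z ^ p s * snd z ^ q s))))"
    by (simp add: set_lebesgue_integral_def scaleR_sum_right)
  also have "\<dots> = (\<Sum>s\<in>S. (LINT z|lborel. indicator (triangle b) z *\<^sub>R (a s * of_real (fst z ^ p s * snd z ^ q s))))"
    by (intro Bochner_Integration.integral_sum set_integrable_triangle[unfolded set_integrable_def] continuous_intros)
  also have "\<dots> = (\<Sum>s\<in>S. a s * of_real (LINT z:triangle b|lborel. fst z ^ p s * snd z ^ q s))"
    by (simp add: set_integral_complex_of_real flip: set_lebesgue_integral_def of_real_power of_real_mult)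
  also have "\<dots> = (\<Sum>s\<in>S. a s * (fact (p s) * fact (q s) / fact (p s + q s + 2)) * of_real b ^ (p s + q s + 2))"
    by (simp add: integral_triangle_monom[OF assms(1)] mult.assoc)
  finally show ?thesis .
qed

text \<open>The fundamental theorem holds for oriented intervals, so \<open>B\<close> may be
  negative. This covers the upper limit \<open>b - bs ! j\<close> without a case
  distinction.\<close>

lemma interval_integral_sum_monom:
  fixes a :: "'s \<Rightarrow> complex"
  shows "(LBINT x=ereal 0..ereal B. (\<Sum>s\<in>S. a s * of_real x ^ p s))
    = (\<Sum>s\<in>S. a s / of_nat (p s + 1) * of_real B ^ (p s + 1))"
proof -
  let ?F = "\<lambda>x::real. \<Sum>s\<in>S. a s / of_nat (p s + 1) * of_real x ^ (p s + 1)"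
  have "(?F has_vector_derivative (\<Sum>s\<in>S. a s * of_real x ^ p s)) (at x within A)" for x A
  proof (rule has_vector_derivative_sum)
    fix s
    have "((\<lambda>x::real. (of_real x :: complex) ^ (p s + 1)) has_vector_derivative
        of_nat (p s + 1) * of_real x ^ p s) (at x within A)"
    proof -
      have "((\<lambda>x. x ^ (p s + 1)) has_field_derivative real (p s + 1) * x ^ p s) (at x within A)"
        using DERIV_pow[of "p s + 1" x A] by simp
      then have "((\<lambda>x. complex_of_real (x ^ (p s + 1))) has_vector_derivative
          of_real (real (p s + 1) * x ^ p s)) (at x within A)"
        by (intro has_vector_derivative_of_real)
      then show ?thesis by simp
    qed
    from has_vector_derivative_mult_right[OF this, of "a s / of_nat (p s + 1)"]
    show "((\<lambda>x::real. a s / of_nat (p s + 1) * of_real x ^ (p s + 1)) has_vector_derivative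
        a s * of_real x ^ p s) (at x within A)"
      by (simp del: of_nat_Suc of_nat_add power_Suc)
  qed
  then have "(LBINT x=ereal 0..ereal B. (\<Sum>s\<in>S. a s * of_real x ^ p s)) = ?F B - ?F 0"
    by (intro interval_integral_FTC_finite continuous_intros) auto
  then show ?thesis by simp
qed

section \<open>The volume polynomial\<close>

text \<open>The bound is an integer because \<open>3 * g - 3 + n\<close> can be negative for
  unstable \<open>(g, n)\<close>; the set is then empty.\<close>

definition bounded_lists :: "nat \<Rightarrow> int \<Rightarrow> nat list set" where
  "bounded_lists n N = {\<beta>. length \<beta> = n \<and> int (sum_list \<beta>) \<le> N}"

lemma finite_bounded_lists [simp]: "finite (bounded_lists n N)"
proof (rule finite_subset)
  show "bounded_lists n N \<subseteq> {\<beta>. set \<beta> \<subseteq> {..nat N} \<and> length \<beta> = n}"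
    by (auto simp: bounded_lists_def dest!: member_le_sum_list)
  show "finite {\<beta>. set \<beta> \<subseteq> {..nat N} \<and> length \<beta> = n}"
    by (rule finite_lists_length_eq) simp
qed

lemma bounded_lists_0: "bounded_lists 0 (int k) = {[]}"
  by (auto simp: bounded_lists_def)

lemma sum_bounded_lists_Suc:
  "(\<Sum>\<beta>\<in>bounded_lists (Suc n) (int k). f \<beta>)
    = (\<Sum>j\<le>k. \<Sum>\<beta>\<in>bounded_lists n (int (k - j)). f (j # \<beta>))"
proof -
  have "bounded_lists (Suc n) (int k) = (\<lambda>p. fst p # snd p) ` (SIGMA j:{..k}. bounded_lists n (int (k - j)))"
    by (force simp: bounded_lists_def length_Suc_conv image_iff)
  moreover have "inj_on (\<lambda>p. fst p # snd p) (SIGMA j:{..k}. bounded_lists n (int (k - j)))"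
    by (auto simp: inj_on_def)
  ultimately show ?thesis
    by (simp add: sum.reindex sum.Sigma case_prod_beta del: of_nat_diff)
qed

text \<open>The factor \<open>\<Prod> (2 \<beta>\<^sub>i)!!\<close>.\<close>

definition even_fact_prod :: "nat list \<Rightarrow> complex" where
  "even_fact_prod \<beta> = prod_list (map (\<lambda>k. 2 ^ k * fact k) \<beta>)"

lemma even_fact_prod_nonzero [simp]: "even_fact_prod \<beta> \<noteq> 0"
  by (induction \<beta>) (auto simp: even_fact_prod_def)

section \<open>Divided powers and the expansion of the exponential class\<close>

context moduli_cohomology
begin

lemma smul_mult_right: "x * smul c y = smul c (x * y)"
  using smul_mult_left[of c y x] by (simp add: mult.commute)

text \<open>The binomial theorem produces natural multiples in the ring; as scalars they can be
  combined with the factorials.\<close>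

lemma of_nat_mult_eq_smul: "of_nat k * x = smul (of_nat k) x"
  by (induction k) (auto simp: scale_left_distrib distrib_right)

lemma smul_power: "smul c x ^ k = smul (c ^ k) (x ^ k)"
  by (induction k) (auto simp: smul_mult_left smul_mult_right mult.commute)

lemma smul_prod: "finite A \<Longrightarrow> (\<Prod>i\<in>A. smul (c i) (x i)) = smul (\<Prod>i\<in>A. c i) (\<Prod>i\<in>A. x i)"
  by (induction A rule: finite_induct) (auto simp: smul_mult_left smul_mult_right mult.commute)

definition divided_power :: "nat \<Rightarrow> 'h \<Rightarrow> 'h" where
  "divided_power k x = smul (1 / fact k) (x ^ k)"

lemma divided_power_0 [simp]: "divided_power 0 x = 1"
  by (simp add: divided_power_def)

lemma divided_power_smul: "divided_power k (smul c x) = smul (c ^ k / fact k) (x ^ k)"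
  by (simp add: divided_power_def smul_power)

text \<open>The binomial coefficient is absorbed by the factorials, leaving a plain convolution that
  iterates to many summands.\<close>

lemma divided_power_add:
  "divided_power k (x + y) = (\<Sum>j\<le>k. divided_power j x * divided_power (k - j) y)"
proof -
  have "divided_power k (x + y) = (\<Sum>j\<le>k. smul (1 / fact k * of_nat (k choose j)) (x ^ j * y ^ (k - j)))"
    unfolding divided_power_def binomial_ring scale_sum_right
    by (simp add: mult.assoc of_nat_mult_eq_smul smul_mult_left)
  also have "\<dots> = (\<Sum>j\<le>k. divided_power j x * divided_power (k - j) y)"
    by (intro sum.cong refl)
       (simp add: divided_power_def smul_mult_left smul_mult_right binomial_fact field_simps)
  finally show ?thesis .
qed

lemma divided_power_add_sum:
  "divided_power k (x + (\<Sum>i<n. y i))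
    = (\<Sum>\<beta>\<in>bounded_lists n (int k).
        divided_power (k - sum_list \<beta>) x * (\<Prod>i<n. divided_power (\<beta> ! i) (y i)))"
proof (induction n arbitrary: k y)
  case 0
  then show ?case by (simp add: bounded_lists_0)
next
  case (Suc n)
  \<comment> \<open>Taking \<open>y 0\<close> out in front leaves a sum of the same shape with
    shifted \<open>y\<close>, and matches splitting off the head of the exponent list.\<close>
  have "divided_power k (x + (\<Sum>i<Suc n. y i)) = divided_power k (y 0 + (x + (\<Sum>i<n. y (Suc i))))"
    by (simp only: sum.lessThan_Suc_shift add_ac)
  also have "\<dots> = (\<Sum>j\<le>k. divided_power j (y 0) * divided_power (k - j) (x + (\<Sum>i<n. y (Suc i))))"
    by (rule divided_power_add)
  also have "\<dots> = (\<Sum>\<beta>\<in>bounded_lists (Suc n) (int k).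
      divided_power (k - sum_list \<beta>) x * (\<Prod>i<Suc n. divided_power (\<beta> ! i) (y i)))"
    unfolding sum_bounded_lists_Suc Suc.IH sum_distrib_left
    by (simp add: prod.lessThan_Suc_shift mult_ac diff_diff_eq del: prod.lessThan_Suc)
  finally show ?case .
qed

text \<open>The coefficient of the product of the \<open>b_i ^ (2 \<beta>_i)\<close>: in order
  \<open>k\<close> of the exponential the psi classes use up \<open>sum_list \<beta>\<close> factors
  and \<open>kappa1\<close> takes the rest. The denominator collects the factors
  \<open>2 ^ \<beta>_i * \<beta>_i!\<close> from the powers of \<open>b_i ^ 2 / 2\<close>.\<close>

definition volume_coeff :: "int \<Rightarrow> nat list \<Rightarrow> complex" where
  "volume_coeff g \<beta> = (let n = length \<beta> in
     if stable g n then
       (\<Sum>k\<in>{sum_list \<beta>..nat (3 * g - 3 + int n)}.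
          integ g n (divided_power (k - sum_list \<beta>) (smul (2 * of_real pi ^ 2) (kappa1 g n))
            * (\<Prod>i<n. psi g n i ^ (\<beta> ! i)))) / even_fact_prod \<beta>
     else 0)"

text \<open>In top degree the only order left is \<open>k = sum_list \<beta>\<close>, where
  \<open>kappa1\<close> has exponent 0, and a pure psi integral remains.\<close>

lemma volume_coeff_top:
  assumes "int (sum_list \<beta>) = 3 * g - 3 + int (length \<beta>)"
  shows "volume_coeff g \<beta> = intersection_number psi integ g (map int \<beta>) / even_fact_prod \<beta>"
proof -
  have top: "{sum_list \<beta>..nat (3 * g - 3 + int (length \<beta>))} = {sum_list \<beta>}"
    using assms by auto
  have "(\<Prod>i<length \<beta>. psi g (length \<beta>) i ^ nat (map int \<beta> ! i))
      = (\<Prod>i<length \<beta>. psi g (length \<beta>) i ^ (\<beta> ! i))"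
    by (intro prod.cong) auto
  then show ?thesis
    by (simp add: volume_coeff_def intersection_number_def Let_def top)
qed

lemma volume_expansion:
  assumes "volume_formula smul psi kappa1 integ V"
  shows "V g xs = (\<Sum>\<beta>\<in>bounded_lists (length xs) (3 * g - 3 + int (length xs)).
           volume_coeff g \<beta> * monom_eval (map ((*) 2) \<beta>) xs)"
proof (cases "stable g (length xs)")
  case False
  then have "V g xs = 0"
    using assms by (simp add: volume_formula_def Let_def)
  with False show ?thesis
    by (auto simp: volume_coeff_def bounded_lists_def intro!: sum.neutral[symmetric])
next
  case True
  define n where "n = length xs"
  define N where "N = nat (3 * g - 3 + int n)"
  define A where "A = smul (2 * of_real pi ^ 2) (kappa1 g n)"
  interpret integ: Vector_Spaces.linear smul "(*)" "integ g n"
    using integ_linear True by (simp add: n_def)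
  have N: "3 * g - 3 + int n = int N"
    using True by (auto simp: N_def n_def stable_def)
  let ?c = "\<lambda>k \<beta>. integ g n (divided_power (k - sum_list \<beta>) A * (\<Prod>i<n. psi g n i ^ (\<beta> ! i)))"
  let ?m = "\<lambda>\<beta>. monom_eval (map ((*) 2) \<beta>) xs / even_fact_prod \<beta>"
  have m: "(\<Prod>i<n. (1 / 2 * (xs ! i) ^ 2) ^ (\<beta> ! i) / fact (\<beta> ! i)) = ?m \<beta>" if "length \<beta> = n" for \<beta>
  proof -
    have "(\<Prod>i<length ys. (1 / 2 * (ys ! i) ^ 2) ^ (\<beta> ! i) / fact (\<beta> ! i))
        = monom_eval (map ((*) 2) \<beta>) ys / even_fact_prod \<beta>" if "length ys = length \<beta>" for ys :: "complex list"
      using that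
      by (induction ys \<beta> rule: list_induct2)
         (simp_all add: prod.lessThan_Suc_shift even_fact_prod_def power_mult power_mult_distrib
           power_divide del: prod.lessThan_Suc)
    then show ?thesis using that by (simp add: n_def)
  qed
  have "V g xs = integ g n (\<Sum>k\<le>N. divided_power k
      (A + (\<Sum>i<n. smul (1 / 2 * (xs ! i) ^ 2) (psi g n i))))"
    using assms True
    by (simp add: volume_formula_def Let_def exp_class_def divided_power_def n_def N_def A_def scale_sum_right)
  also have "\<dots> = (\<Sum>k\<le>N. \<Sum>\<beta>\<in>bounded_lists n (int k). ?c k \<beta> * ?m \<beta>)"
    unfolding divided_power_add_sum integ.sum
    by (intro sum.cong refl)
       (auto simp: divided_power_smul smul_prod smul_mult_right integ.scale m[symmetric] bounded_lists_def mult.commute)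
  \<comment> \<open>The range of \<open>\<beta>\<close> depends on \<open>k\<close> only through the
    condition \<open>sum_list \<beta> \<le> k\<close>, so the two sums can be swapped.\<close>
  also have "\<dots> = (\<Sum>k\<le>N. \<Sum>\<beta> | \<beta> \<in> bounded_lists n (int N) \<and> sum_list \<beta> \<le> k. ?c k \<beta> * ?m \<beta>)"
    by (intro sum.cong) (auto simp: bounded_lists_def)
  also have "\<dots> = (\<Sum>\<beta>\<in>bounded_lists n (int N). \<Sum>k | k \<in> {..N} \<and> sum_list \<beta> \<le> k. ?c k \<beta> * ?m \<beta>)"
    by (rule sum.swap_restrict) auto
  also have "\<dots> = (\<Sum>\<beta>\<in>bounded_lists n (int N). volume_coeff g \<beta> * monom_eval (map ((*) 2) \<beta>) xs)"
  proof (intro sum.cong refl)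
    fix \<beta> assume "\<beta> \<in> bounded_lists n (int N)"
    then have len: "length \<beta> = n" by (simp add: bounded_lists_def)
    have "(\<Sum>k | k \<in> {..N} \<and> sum_list \<beta> \<le> k. ?c k \<beta> * ?m \<beta>) = (\<Sum>k\<in>{sum_list \<beta>..N}. ?c k \<beta> * ?m \<beta>)"
      by (intro sum.cong) auto
    also have "\<dots> = volume_coeff g \<beta> * monom_eval (map ((*) 2) \<beta>) xs"
      using True by (simp add: volume_coeff_def Let_def len A_def N_def n_def sum_distrib_right sum_divide_distrib)
    finally show "(\<Sum>k | k \<in> {..N} \<and> sum_list \<beta> \<le> k. ?c k \<beta> * ?m \<beta>)
        = volume_coeff g \<beta> * monom_eval (map ((*) 2) \<beta>) xs" .
  qed
  finally show ?thesis by (simp only: n_def[symmetric] N)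
qed

end

section \<open>Coefficients of the recursion\<close>

lemma double_fact_even: "double_fact (2 * int k) = 2 ^ k * fact k"
proof (induction k)
  case 0
  show ?case by (simp add: double_fact.simps)
next
  case (Suc k)
  have "double_fact (2 * int (Suc k)) = nat (2 * int (Suc k)) * double_fact (2 * int (Suc k) - 2)"
    by (subst double_fact.simps) simp
  also have "2 * int (Suc k) - 2 = 2 * int k" by simp
  also have "nat (2 * int (Suc k)) = 2 * Suc k" by simp
  finally show ?case unfolding Suc.IH by (simp add: algebra_simps)
qed

text \<open>\<open>2 ^ k * fact k\<close> is the product of the even factors of
  \<open>(2k+1)!\<close>, and the double factorial is that of the odd ones.\<close>

lemma double_fact_odd: "double_fact (2 * int k + 1) * (2 ^ k * fact k) = fact (2 * k + 1)"
proof (induction k)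
  case 0
  show ?case by (simp add: double_fact.simps[of 1] double_fact.simps[of "-1"])
next
  case (Suc k)
  have "double_fact (2 * int (Suc k) + 1) = nat (2 * int (Suc k) + 1) * double_fact (2 * int (Suc k) + 1 - 2)"
    by (subst double_fact.simps) simp
  also have "2 * int (Suc k) + 1 - 2 = 2 * int k + 1" by simp
  also have "nat (2 * int (Suc k) + 1) = 2 * k + 3" by simp
  finally have "double_fact (2 * int (Suc k) + 1) * (2 ^ Suc k * fact (Suc k))
      = (2 * k + 3) * (2 * Suc k) * (double_fact (2 * int k + 1) * (2 ^ k * fact k))"
    by (simp add: algebra_simps)
  also have "\<dots> = fact (2 * Suc k + 1)"
    unfolding Suc.IH by (simp add: algebra_simps)
  finally show ?case .
qed

text \<open>For positive \<open>k\<close> the factor \<open>2 * k\<close> is split off and the odd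
  case applies; for \<open>k = 0\<close> this is the convention (-1)!! = 1.\<close>

lemma double_fact_even_pred: "double_fact (2 * int k - 1) * (2 ^ k * fact k) = fact (2 * k)"
proof (cases k)
  case 0
  then show ?thesis by (simp add: double_fact.simps)
next
  case (Suc j)
  have "double_fact (2 * int k - 1) * (2 ^ k * fact k)
      = 2 * Suc j * (double_fact (2 * int j + 1) * (2 ^ j * fact j))"
    by (simp add: Suc algebra_simps)
  also have "\<dots> = fact (2 * k)"
    unfolding double_fact_odd by (simp add: Suc algebra_simps)
  finally show ?thesis .
qed

lemma sum_eq_single:
  assumes "finite A" "a \<in> A" "\<And>x. x \<in> A \<Longrightarrow> x \<noteq> a \<Longrightarrow> f x = 0"
  shows "sum f A = f a"
  using assms sum.mono_neutral_right[of A "{a}" f] by auto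

lemma nths_singleton: "j < length xs \<Longrightarrow> nths xs {j} = [xs ! j]"
proof (induction xs arbitrary: j)
  case (Cons x xs)
  then show ?case by (cases j) (auto simp: nths_Cons)
qed simp

lemma length_nths_eq: "length xs = length ys \<Longrightarrow> length (nths xs I) = length (nths ys I)"
  by (simp add: length_nths)

lemma length_nths_Compl: "length xs = length (nths xs I) + length (nths xs (- I))"
  using sum_list_nths_Compl[of "map (\<lambda>_. 1 :: nat) xs" I] by (simp add: nths_map sum_list_triv)

abbreviation double :: "nat list \<Rightarrow> nat list" where
  "double \<equiv> map ((*) 2)"

lemma sum_list_double [simp]: "sum_list (double \<beta>) = 2 * sum_list \<beta>"
  by (induction \<beta>) auto

lemma double_eq_iff [simp]: "double \<beta> = double \<gamma> \<longleftrightarrow> \<beta> = \<gamma>"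
  by (simp add: inj_map_eq_map inj_def)

lemma merge_eq_iff:
  assumes "length xs = length (nths zs I)" "length ys = length (nths zs (- I))"
  shows "merge I (length zs) xs ys = zs \<longleftrightarrow> xs = nths zs I \<and> ys = nths zs (- I)"
  using nths_merge[OF assms] merge_nths[of I zs] by auto

lemma sum_list_merge:
  fixes xs :: "'a::comm_monoid_add list"
  assumes "length xs = length (nths zs I)" "length ys = length (nths zs (- I))"
  shows "sum_list (merge I (length zs) xs ys) = sum_list xs + sum_list ys"
  using sum_list_nths_Compl[of "merge I (length zs) xs ys" I] by (simp add: nths_merge[OF assms])

lemma monom_eval_merge:
  assumes "length \<beta> = length (nths xs I)" "length \<gamma> = length (nths xs (- I))"
  shows "monom_eval (merge I (length xs) \<beta> \<gamma>) xs
    = monom_eval \<beta> (nths xs I) * monom_eval \<gamma> (nths xs (- I))"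
  by (subst monom_eval_nths_Compl[of _ _ I]) (simp add: nths_merge[OF assms])

text \<open>The terms with even \<open>k\<close> cancel but stay in the sum with coefficient zero,
  which keeps the index set a segment.\<close>

lemma odd_binomial_sum:
  fixes x y :: "'a::comm_ring_1"
  shows "(x + y) ^ m - (x - y) ^ m = (\<Sum>k\<le>m. of_nat (m choose k) * (y ^ k - (- y) ^ k) * x ^ (m - k))"
  using binomial_ring[of y x m] binomial_ring[of "- y" x m]
  by (simp add: algebra_simps sum_subtractf)

lemma even_binomial_sum:
  fixes x y :: "'a::comm_ring_1"
  shows "(x + y) ^ m + (x - y) ^ m = (\<Sum>k\<le>m. of_nat (m choose k) * (1 + (- 1) ^ k) * (y ^ k * x ^ (m - k)))"
  using binomial_ring[of y x m] binomial_ring[of "- y" x m]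
  by (simp add: algebra_simps sum.distrib power_minus[of y])

abbreviation exponents :: "int \<Rightarrow> nat \<Rightarrow> nat list set" where
  "exponents g n \<equiv> bounded_lists n (3 * g - 3 + int n)"

text \<open>The constant \<open>p! q! / (p + q + 2)!\<close> at odd exponents: the weight b' b'' of
  the recursion raises the even exponents \<open>2 * \<mu>\<close> and \<open>2 * \<nu>\<close> by
  one.\<close>

definition triangle_coeff :: "nat \<Rightarrow> nat \<Rightarrow> complex" where
  "triangle_coeff \<mu> \<nu> = fact (2 * \<mu> + 1) * fact (2 * \<nu> + 1) / fact (2 * (\<mu> + \<nu> + 2))"

lemma integral_triangle_odd_sum:
  fixes a :: "'s \<Rightarrow> complex"
  assumes "0 \<le> b" "finite S"
  shows "(LINT z:triangle b|lborel. (\<Sum>s\<in>S. a s * (of_real (fst z) ^ (2 * p s + 1) * of_real (snd z) ^ (2 * q s + 1))))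
    = (\<Sum>s\<in>S. a s * triangle_coeff (p s) (q s) * of_real b ^ (2 * (p s + q s + 2)))"
proof -
  have e: "2 * k + 1 + (2 * l + 1) + 2 = 2 * (k + l + 2)" for k l :: nat by simp
  show ?thesis
    unfolding integral_triangle_sum[OF assms] e triangle_coeff_def ..
qed

text \<open>Comparing coefficients uses only that the volumes are polynomials in the squares with
  this degree bound; the coefficients stay abstract until \<open>volume_coeff\<close> is
  inserted.\<close>

locale polynomial_volumes =
  fixes V :: "int \<Rightarrow> complex list \<Rightarrow> complex" and c :: "int \<Rightarrow> nat list \<Rightarrow> complex"
  assumes expansion:
    "V g xs = (\<Sum>\<beta>\<in>exponents g (length xs). c g \<beta> * monom_eval (double \<beta>) xs)"
begin

lemma expansion_Cons:
  "V g (x # xs) = (\<Sum>\<beta>\<in>exponents g (Suc (length xs)).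
     c g \<beta> * (x ^ (2 * hd \<beta>) * monom_eval (double (tl \<beta>)) xs))"
  unfolding expansion by (auto simp: bounded_lists_def length_Suc_conv intro!: sum.cong)

lemma expansion_Cons2:
  "V g (x # y # xs) = (\<Sum>\<beta>\<in>exponents g (Suc (Suc (length xs))).
     c g \<beta> * (x ^ (2 * hd \<beta>) * (y ^ (2 * hd (tl \<beta>)) * monom_eval (double (tl (tl \<beta>))) xs)))"
  unfolding expansion by (auto simp: bounded_lists_def length_Suc_conv intro!: sum.cong)

text \<open>In the binomial expansion of the difference the term with \<open>k = 0\<close> cancels,
  \<open>k = 1\<close> yields \<open>(2 * d + 1) * b ^ (2 * d)\<close>, and every larger
  \<open>k\<close> falls below top degree.\<close>

lemma has_coefficient_lhs:
  assumes deg: "int (d + sum_list ds) = 3 * g - 3 + int (Suc (length ds))"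
  shows "has_coefficient (Suc (length ds)) (2 * (3 * g - 3 + int (Suc (length ds))))
           (recursion_lhs V g) (double (d # ds)) (of_nat (2 * d + 1) * c g (d # ds))"
proof -
  let ?n = "Suc (length ds)"
  define z where "z = 2 * complex_of_real pi * \<i>"
  have z: "z \<noteq> 0" by (simp add: z_def)
  define S where "S = (SIGMA \<beta>:exponents g ?n. {..2 * hd \<beta> + 1})"
  define a where "a = (\<lambda>(\<beta>, k). c g \<beta> * (of_nat ((2 * hd \<beta> + 1) choose k) * (z ^ k - (- z) ^ k) / (2 * z)))"
  define \<delta> where "\<delta> = (\<lambda>(\<beta>, k::nat). (2 * hd \<beta> + 1 - k) # double (tl \<beta>))"
  have fin: "finite S" by (simp add: S_def)
  have *: "has_coefficient ?n (2 * (3 * g - 3 + int ?n)) (recursion_lhs V g) (double (d # ds))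
      (\<Sum>s\<in>S. if \<delta> s = double (d # ds) then a s else 0)"
  proof (rule has_coefficient_sum_monom[OF fin])
    fix s assume s: "s \<in> S" "a s \<noteq> 0"
    obtain \<beta> k where [simp]: "s = (\<beta>, k)" by force
    \<comment> \<open>For \<open>k = 0\<close> the exponent \<open>2 * h + 1\<close> would exceed
      the degree bound by one in top degree; its coefficient is \<open>1 - 1 = 0\<close>.\<close>
    have "k \<noteq> 0" using s(2) by (intro notI) (simp add: a_def)
    moreover obtain h \<gamma> where "\<beta> = h # \<gamma>" "length \<gamma> = length ds"
      using s(1) by (auto simp: S_def bounded_lists_def length_Suc_conv)
    ultimately show "length (\<delta> s) = ?n \<and> int (sum_list (\<delta> s)) \<le> 2 * (3 * g - 3 + int ?n)"
      using s(1) by (auto simp: S_def \<delta>_def bounded_lists_def)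
  next
    fix b :: real and bs :: "real list" assume len: "length (b # bs) = ?n"
    let ?b = "complex_of_real b" and ?bs = "map complex_of_real bs"
    let ?m = "\<lambda>\<beta>. monom_eval (double (tl \<beta>)) ?bs"
    have alg: "1 / (2 * z) * (u * (k * (u ^ (2 * h) * M)) - v * (k * (v ^ (2 * h) * M)))
        = k * (((u ^ (2 * h + 1) - v ^ (2 * h + 1)) / (2 * z)) * M)" for u v k M :: complex and h
      using z by (simp add: field_simps)
    have "recursion_lhs V g b bs = 1 / (2 * z) * ((?b + z) * V g ((?b + z) # ?bs) - (?b - z) * V g ((?b - z) # ?bs))"
      by (simp add: recursion_lhs_def Let_def z_def)
    also have "\<dots> = (\<Sum>\<beta>\<in>exponents g ?n.
        c g \<beta> * ((((?b + z) ^ (2 * hd \<beta> + 1) - (?b - z) ^ (2 * hd \<beta> + 1)) / (2 * z)) * ?m \<beta>))"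
      using len unfolding expansion_Cons sum_distrib_left sum_subtractf[symmetric]
      by (intro sum.cong alg) simp
    also have "\<dots> = (\<Sum>\<beta>\<in>exponents g ?n. \<Sum>k\<le>2 * hd \<beta> + 1. a (\<beta>, k) * (?b ^ (2 * hd \<beta> + 1 - k) * ?m \<beta>))"
      unfolding odd_binomial_sum sum_divide_distrib sum_distrib_right sum_distrib_left a_def
      by (intro sum.cong) (auto simp: mult_ac)
    also have "\<dots> = (\<Sum>s\<in>S. a s * monom_eval (\<delta> s) (map of_real (b # bs)))"
      unfolding S_def by (subst sum.Sigma) (auto simp: \<delta>_def intro!: sum.cong)
    finally show "recursion_lhs V g b bs = (\<Sum>s\<in>S. a s * monom_eval (\<delta> s) (map of_real (b # bs)))" .
  qed
  have "(\<Sum>s\<in>S. if \<delta> s = double (d # ds) then a s else 0)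
      = (if \<delta> (d # ds, 1) = double (d # ds) then a (d # ds, 1) else 0)"
  proof (rule sum_eq_single[OF fin])
    show "(d # ds, 1) \<in> S" using deg by (auto simp: S_def bounded_lists_def)
    fix s assume s: "s \<in> S" "s \<noteq> (d # ds, 1)"
    obtain h \<gamma> k where [simp]: "s = (h # \<gamma>, k)" and "length \<gamma> = length ds"
      using s(1) by (auto simp: S_def bounded_lists_def length_Suc_conv)
    have "False" if "\<delta> s = double (d # ds)"
    proof -
      have \<gamma>: "\<gamma> = ds" "2 * h + 1 - k = 2 * d" using that by (auto simp: \<delta>_def)
      \<comment> \<open>Equality of exponents gives \<open>k = 2 * (h - d) + 1\<close>, and the
        degree bound \<open>h \<le> d\<close> leaves only \<open>h = d\<close>,
        \<open>k = 1\<close>. The bound on \<open>k\<close> excludes truncated subtraction.\<close>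
      moreover have "h \<le> d" using s(1) deg \<gamma> by (auto simp: S_def bounded_lists_def)
      moreover have "k \<le> 2 * h + 1" using s(1) by (auto simp: S_def)
      ultimately have "h = d \<and> k = 1" by arith
      then show False using s(2) \<gamma> by simp
    qed
    then show "(if \<delta> s = double (d # ds) then a s else 0) = 0" by auto
  qed
  also have "\<dots> = of_nat (2 * d + 1) * c g (d # ds)"
    using z by (simp add: \<delta>_def a_def)
  finally show ?thesis using * by simp
qed

text \<open>The volume of genus \<open>g - 1\<close> with one more boundary has dimension smaller by
  2, which the \<open>+ 2\<close> in the exponent of \<open>b\<close> restores.\<close>

lemma has_coefficient_nonseparating:
  assumes deg: "int (d + sum_list ds) = 3 * g - 3 + int (Suc (length ds))"
  shows "has_coefficient (Suc (length ds)) (2 * (3 * g - 3 + int (Suc (length ds))))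
    (\<lambda>b bs. LINT p:triangle b|lborel. of_real (fst p) * of_real (snd p)
       * V (g - 1) (of_real (fst p) # of_real (snd p) # map complex_of_real bs))
    (double (d # ds))
    (\<Sum>(\<mu>, \<nu>) | \<mu> + \<nu> + 2 = d. c (g - 1) (\<mu> # \<nu> # ds) * triangle_coeff \<mu> \<nu>)"
proof -
  let ?n = "Suc (length ds)"
  define S where "S = exponents (g - 1) (Suc ?n)"
  define a where "a = (\<lambda>\<beta>. c (g - 1) \<beta> * triangle_coeff (hd \<beta>) (hd (tl \<beta>)))"
  define \<delta> where "\<delta> = (\<lambda>\<beta>. (2 * (hd \<beta> + hd (tl \<beta>) + 2)) # double (tl (tl \<beta>)))"
  have fin: "finite S" by (simp add: S_def)
  have "has_coefficient ?n (2 * (3 * g - 3 + int ?n))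
    (\<lambda>b bs. LINT p:triangle b|lborel. of_real (fst p) * of_real (snd p)
       * V (g - 1) (of_real (fst p) # of_real (snd p) # map complex_of_real bs))
    (double (d # ds)) (\<Sum>s\<in>S. if \<delta> s = double (d # ds) then a s else 0)"
  proof (rule has_coefficient_sum_monom[OF fin])
    fix \<beta> assume "\<beta> \<in> S"
    then show "length (\<delta> \<beta>) = ?n \<and> int (sum_list (\<delta> \<beta>)) \<le> 2 * (3 * g - 3 + int ?n)"
      by (auto simp: S_def \<delta>_def bounded_lists_def length_Suc_conv)
  next
    fix b :: real and bs :: "real list"
    assume len: "length (b # bs) = ?n" and "\<forall>x\<in>set (b # bs). 0 \<le> x"
    then have b: "0 \<le> b" by simp
    let ?m = "\<lambda>\<beta>. monom_eval (double (tl (tl \<beta>))) (map complex_of_real bs)"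
    have "complex_of_real (fst p) * of_real (snd p) * V (g - 1) (of_real (fst p) # of_real (snd p) # map complex_of_real bs)
      = (\<Sum>\<beta>\<in>S. (c (g - 1) \<beta> * ?m \<beta>) * (of_real (fst p) ^ (2 * hd \<beta> + 1) * of_real (snd p) ^ (2 * hd (tl \<beta>) + 1)))" for p
      using len unfolding expansion_Cons2 sum_distrib_left S_def
      by (intro sum.cong) (auto simp: mult_ac)
    then have "(LINT p:triangle b|lborel. of_real (fst p) * of_real (snd p)
         * V (g - 1) (of_real (fst p) # of_real (snd p) # map complex_of_real bs))
      = (\<Sum>\<beta>\<in>S. c (g - 1) \<beta> * ?m \<beta> * triangle_coeff (hd \<beta>) (hd (tl \<beta>))
          * of_real b ^ (2 * (hd \<beta> + hd (tl \<beta>) + 2)))"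
      by (simp only: integral_triangle_odd_sum[OF b fin])
    also have "\<dots> = (\<Sum>\<beta>\<in>S. a \<beta> * monom_eval (\<delta> \<beta>) (map of_real (b # bs)))"
      by (intro sum.cong refl) (simp add: a_def \<delta>_def mult_ac)
    finally show "(LINT p:triangle b|lborel. of_real (fst p) * of_real (snd p)
         * V (g - 1) (of_real (fst p) # of_real (snd p) # map complex_of_real bs))
      = (\<Sum>\<beta>\<in>S. a \<beta> * monom_eval (\<delta> \<beta>) (map of_real (b # bs)))" .
  qed
  also have "(\<Sum>s\<in>S. if \<delta> s = double (d # ds) then a s else 0) = (\<Sum>s | s \<in> S \<and> \<delta> s = double (d # ds). a s)"
    using fin by (rule sum.inter_filter[symmetric])
  also have "\<dots> = (\<Sum>(\<mu>, \<nu>) | \<mu> + \<nu> + 2 = d. c (g - 1) (\<mu> # \<nu> # ds) * triangle_coeff \<mu> \<nu>)"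
  proof (rule sum.reindex_bij_witness[where i = "\<lambda>(\<mu>, \<nu>). \<mu> # \<nu> # ds" and j = "\<lambda>\<beta>. (hd \<beta>, hd (tl \<beta>))"])
    fix \<beta> assume "\<beta> \<in> {s \<in> S. \<delta> s = double (d # ds)}"
    moreover then obtain \<mu> \<nu> \<gamma> where "\<beta> = \<mu> # \<nu> # \<gamma>"
      by (auto simp: S_def bounded_lists_def length_Suc_conv)
    ultimately show "(case (hd \<beta>, hd (tl \<beta>)) of (\<mu>, \<nu>) \<Rightarrow> \<mu> # \<nu> # ds) = \<beta>"
      "(hd \<beta>, hd (tl \<beta>)) \<in> {(\<mu>, \<nu>). \<mu> + \<nu> + 2 = d}"
      "(case (hd \<beta>, hd (tl \<beta>)) of (\<mu>, \<nu>) \<Rightarrow> c (g - 1) (\<mu> # \<nu> # ds) * triangle_coeff \<mu> \<nu>) = a \<beta>"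
      by (auto simp: \<delta>_def a_def)
  next
    fix p :: "nat \<times> nat" assume "p \<in> {(\<mu>, \<nu>). \<mu> + \<nu> + 2 = d}"
    \<comment> \<open>Membership in \<open>S\<close> is automatic:
      \<open>\<mu> + \<nu> + 2 = d\<close> and the degree hypothesis make the total exponent exactly
      \<open>3 * (g - 1) - 3 + (n + 1)\<close>.\<close>
    then show "(case p of (\<mu>, \<nu>) \<Rightarrow> \<mu> # \<nu> # ds) \<in> {s \<in> S. \<delta> s = double (d # ds)}"
      using deg by (auto simp: S_def \<delta>_def bounded_lists_def)
  qed auto
  finally show ?thesis .
qed

text \<open>\<open>\<mu>\<close> and \<open>\<nu>\<close> are the first exponents that bring each
  volume to its own top degree. At most one pair of exponent lists contributes, and none if one of
  the two is negative.\<close>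

lemma has_coefficient_separating:
  fixes I :: "nat set"
  assumes deg: "int (d + sum_list ds) = 3 * (g1 + g2) - 3 + int (Suc (length ds))"
  defines "\<mu> \<equiv> 3 * g1 - 3 + int (Suc (length (nths ds I))) - int (sum_list (nths ds I))"
    and "\<nu> \<equiv> 3 * g2 - 3 + int (Suc (length (nths ds (- I)))) - int (sum_list (nths ds (- I)))"
  shows "has_coefficient (Suc (length ds)) (2 * (3 * (g1 + g2) - 3 + int (Suc (length ds))))
    (\<lambda>b bs. LINT p:triangle b|lborel. of_real (fst p) * of_real (snd p)
       * V g1 (of_real (fst p) # nths (map complex_of_real bs) I)
       * V g2 (of_real (snd p) # nths (map complex_of_real bs) (- I)))
    (double (d # ds))
    (if 0 \<le> \<mu> \<and> 0 \<le> \<nu>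
     then c g1 (nat \<mu> # nths ds I) * c g2 (nat \<nu> # nths ds (- I)) * triangle_coeff (nat \<mu>) (nat \<nu>)
     else 0)"
proof -
  let ?n = "Suc (length ds)"
  let ?ds1 = "nths ds I" and ?ds2 = "nths ds (- I)"
  note length_Compl = length_nths_Compl[of ds I] and sum_Compl = sum_list_nths_Compl[of ds I]
  define S where "S = exponents g1 (Suc (length ?ds1)) \<times> exponents g2 (Suc (length ?ds2))"
  define a where "a = (\<lambda>(\<beta>, \<gamma>). c g1 \<beta> * c g2 \<gamma> * triangle_coeff (hd \<beta>) (hd \<gamma>))"
  define \<delta> where "\<delta> = (\<lambda>(\<beta>, \<gamma>). (2 * (hd \<beta> + hd \<gamma> + 2)) # merge I (length ds) (double (tl \<beta>)) (double (tl \<gamma>)))"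
  have fin: "finite S" by (simp add: S_def)
  have *: "has_coefficient ?n (2 * (3 * (g1 + g2) - 3 + int ?n))
    (\<lambda>b bs. LINT p:triangle b|lborel. of_real (fst p) * of_real (snd p)
       * V g1 (of_real (fst p) # nths (map complex_of_real bs) I)
       * V g2 (of_real (snd p) # nths (map complex_of_real bs) (- I)))
    (double (d # ds)) (\<Sum>s\<in>S. if \<delta> s = double (d # ds) then a s else 0)"
  proof (rule has_coefficient_sum_monom[OF fin])
    fix s assume "s \<in> S"
    then obtain h \<beta> k \<gamma> where "s = (h # \<beta>, k # \<gamma>)" "length \<beta> = length ?ds1" "length \<gamma> = length ?ds2"
      "int (h + sum_list \<beta>) \<le> 3 * g1 - 3 + int (Suc (length ?ds1))"
      "int (k + sum_list \<gamma>) \<le> 3 * g2 - 3 + int (Suc (length ?ds2))"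
      by (auto simp: S_def bounded_lists_def length_Suc_conv)
    then show "length (\<delta> s) = ?n \<and> int (sum_list (\<delta> s)) \<le> 2 * (3 * (g1 + g2) - 3 + int ?n)"
      using length_Compl sum_list_merge[of "double \<beta>" ds I "double \<gamma>"]
      by (simp add: \<delta>_def del: merge.simps)
  next
    fix b :: real and bs :: "real list"
    assume len: "length (b # bs) = ?n" and "\<forall>x\<in>set (b # bs). 0 \<le> x"
    then have b: "0 \<le> b" by simp
    let ?bs = "map complex_of_real bs"
    let ?m = "\<lambda>\<beta> \<gamma>. monom_eval (double (tl \<beta>)) (nths ?bs I) * monom_eval (double (tl \<gamma>)) (nths ?bs (- I))"
    have lens: "length (nths ?bs J) = length (nths ds J)" for J
      using len by (intro length_nths_eq) simp
    have m: "?m (fst s) (snd s) = monom_eval (merge I (length ds) (double (tl (fst s))) (double (tl (snd s)))) ?bs"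
      if "s \<in> S" for s
      using that len by (subst monom_eval_merge[symmetric]) (auto simp: S_def bounded_lists_def lens)
    have "complex_of_real (fst p) * of_real (snd p) * V g1 (of_real (fst p) # nths ?bs I) * V g2 (of_real (snd p) # nths ?bs (- I))
      = (\<Sum>s\<in>S. (c g1 (fst s) * c g2 (snd s) * ?m (fst s) (snd s))
           * (of_real (fst p) ^ (2 * hd (fst s) + 1) * of_real (snd p) ^ (2 * hd (snd s) + 1)))" for p
    proof -
      \<comment> \<open>Each weight is attached to its own volume, so the integrand becomes a
        product of two sums and hence one sum over \<open>S\<close>.\<close>
      have expand: "of_real x * V h (of_real x # nths ?bs J)
        = (\<Sum>\<beta>\<in>exponents h (Suc (length (nths ds J))).
            c h \<beta> * (monom_eval (double (tl \<beta>)) (nths ?bs J) * of_real x ^ (2 * hd \<beta> + 1)))" for x h J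
        unfolding expansion_Cons lens sum_distrib_left by (intro sum.cong) (auto simp: mult_ac)
      have "complex_of_real (fst p) * of_real (snd p) * V g1 (of_real (fst p) # nths ?bs I) * V g2 (of_real (snd p) # nths ?bs (- I))
        = (of_real (fst p) * V g1 (of_real (fst p) # nths ?bs I)) * (of_real (snd p) * V g2 (of_real (snd p) # nths ?bs (- I)))"
        by (simp add: mult_ac)
      also have "\<dots> = (\<Sum>s\<in>S. (c g1 (fst s) * c g2 (snd s) * ?m (fst s) (snd s))
           * (of_real (fst p) ^ (2 * hd (fst s) + 1) * of_real (snd p) ^ (2 * hd (snd s) + 1)))"
        unfolding expand sum_product S_def sum.cartesian_product
        by (intro sum.cong) (auto simp: mult_ac)
      finally show ?thesis .
    qed
    then have "(LINT p:triangle b|lborel. of_real (fst p) * of_real (snd p)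
         * V g1 (of_real (fst p) # nths ?bs I) * V g2 (of_real (snd p) # nths ?bs (- I)))
      = (\<Sum>s\<in>S. c g1 (fst s) * c g2 (snd s) * ?m (fst s) (snd s)
          * triangle_coeff (hd (fst s)) (hd (snd s)) * of_real b ^ (2 * (hd (fst s) + hd (snd s) + 2)))"
      by (simp only: integral_triangle_odd_sum[OF b fin])
    also have "\<dots> = (\<Sum>s\<in>S. a s * monom_eval (\<delta> s) (map of_real (b # bs)))"
      by (intro sum.cong refl) (simp add: m a_def \<delta>_def case_prod_beta mult_ac)
    finally show "(LINT p:triangle b|lborel. of_real (fst p) * of_real (snd p)
         * V g1 (of_real (fst p) # nths ?bs I) * V g2 (of_real (snd p) # nths ?bs (- I)))
      = (\<Sum>s\<in>S. a s * monom_eval (\<delta> s) (map of_real (b # bs)))" .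
  qed
  have match: "int h = \<mu> \<and> int k = \<nu> \<and> \<beta> = ?ds1 \<and> \<gamma> = ?ds2"
    if "(h # \<beta>, k # \<gamma>) \<in> S" "\<delta> (h # \<beta>, k # \<gamma>) = double (d # ds)" for h \<beta> k \<gamma>
  proof -
    have len: "length \<beta> = length ?ds1" "length \<gamma> = length ?ds2"
      using that(1) by (auto simp: S_def bounded_lists_def)
    have "2 * (h + k + 2) = 2 * d" "merge I (length (double ds)) (double \<beta>) (double \<gamma>) = double ds"
      using that(2) by (auto simp: \<delta>_def)
    then have "h + k + 2 = d" "\<beta> = ?ds1" "\<gamma> = ?ds2"
      using len merge_eq_iff[of "double \<beta>" "double ds" I "double \<gamma>"] by (simp_all add: nths_map)
    \<comment> \<open>The separate degree bounds give two inequalities, while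
      \<open>h + k = d - 2 = \<mu> + \<nu>\<close>; hence both are equalities.\<close>
    moreover from this have "int h \<le> \<mu>" "int k \<le> \<nu>"
      using that(1) by (auto simp: S_def bounded_lists_def \<mu>_def \<nu>_def)
    moreover have "\<mu> + \<nu> + 2 = int d"
      using deg length_Compl sum_Compl unfolding \<mu>_def \<nu>_def by simp
    ultimately show ?thesis by auto
  qed
  have "(\<Sum>s\<in>S. if \<delta> s = double (d # ds) then a s else 0)
      = (if 0 \<le> \<mu> \<and> 0 \<le> \<nu>
         then c g1 (nat \<mu> # ?ds1) * c g2 (nat \<nu> # ?ds2) * triangle_coeff (nat \<mu>) (nat \<nu>) else 0)"
  proof (cases "0 \<le> \<mu> \<and> 0 \<le> \<nu>")
    case False
    have "(if \<delta> s = double (d # ds) then a s else 0) = 0" if s_in: "s \<in> S" for s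
    proof -
      obtain h \<beta> k \<gamma> where s: "s = (h # \<beta>, k # \<gamma>)"
        using s_in by (auto simp: S_def bounded_lists_def length_Suc_conv)
      show ?thesis using match[of h \<beta> k \<gamma>] s_in False by (auto simp: s)
    qed
    then have "(\<Sum>s\<in>S. if \<delta> s = double (d # ds) then a s else 0) = 0" by (intro sum.neutral) blast
    then show ?thesis using False by auto
  next
    case True
    let ?s = "(nat \<mu> # ?ds1, nat \<nu> # ?ds2)"
    have "(\<Sum>s\<in>S. if \<delta> s = double (d # ds) then a s else 0)
        = (if \<delta> ?s = double (d # ds) then a ?s else 0)"
    proof (rule sum_eq_single[OF fin])
      show "?s \<in> S" using True by (auto simp: S_def bounded_lists_def \<mu>_def \<nu>_def)
      fix s assume s: "s \<in> S" "s \<noteq> ?s"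
      then obtain h \<beta> k \<gamma> where "s = (h # \<beta>, k # \<gamma>)"
        by (auto simp: S_def bounded_lists_def length_Suc_conv)
      then show "(if \<delta> s = double (d # ds) then a s else 0) = 0"
        using match[of h \<beta> k \<gamma>] s by auto
    qed
    moreover have "\<delta> ?s = double (d # ds)"
    proof -
      have "\<mu> + \<nu> + 2 = int d"
        using deg length_Compl sum_Compl unfolding \<mu>_def \<nu>_def by simp
      then have "nat \<mu> + nat \<nu> + 2 = d"
        using True by linarith
      moreover have "merge I (length ds) (double ?ds1) (double ?ds2) = double ds"
        using merge_nths[of I "double ds"] by (simp add: nths_map)
      ultimately show ?thesis by (simp add: \<delta>_def)
    qed
    ultimately show ?thesis using True by (simp add: a_def)
  qed
  with * show ?thesis by simp
qed

text \<open>The integrals produce \<open>1 / (2 * h + 2)\<close> times the even part of a binomial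
  expansion, whose parity factor is 2; together they leave the binomial coefficient over
  \<open>h + 1 = d + ds ! j\<close>.\<close>

lemma has_coefficient_boundary:
  assumes deg: "int (d + sum_list ds) = 3 * g - 3 + int (Suc (length ds))" and j: "j < length ds"
  shows "has_coefficient (Suc (length ds)) (2 * (3 * g - 3 + int (Suc (length ds))))
    (\<lambda>b bs. (LBINT x=ereal 0..ereal (b + bs ! j). of_real x * V g (of_real x # nths (map complex_of_real bs) (- {j})))
      + (LBINT x=ereal 0..ereal (b - bs ! j). of_real x * V g (of_real x # nths (map complex_of_real bs) (- {j}))))
    (double (d # ds))
    (if d + ds ! j = 0 then 0
     else c g ((d + ds ! j - 1) # nths ds (- {j}))
       * of_nat ((2 * (d + ds ! j)) choose (2 * ds ! j)) / of_nat (d + ds ! j))"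
proof -
  let ?n = "Suc (length ds)"
  let ?ds = "nths ds (- {j})"
  have single: "nths ds {j} = [ds ! j]" using j by (rule nths_singleton)
  have length_ds: "length ds = Suc (length ?ds)" and sum_ds: "sum_list ds = ds ! j + sum_list ?ds"
    using length_nths_Compl[of ds "{j}"] sum_list_nths_Compl[of ds "{j}"] by (simp_all add: single)
  define S where "S = (SIGMA \<beta>:exponents g (Suc (length ?ds)). {..2 * hd \<beta> + 2})"
  define a :: "nat list \<times> nat \<Rightarrow> complex"
    where "a = (\<lambda>(\<beta>, k). c g \<beta> / of_nat (2 * hd \<beta> + 2) * (of_nat ((2 * hd \<beta> + 2) choose k) * (1 + (- 1) ^ k)))"
  \<comment> \<open>The power \<open>k\<close> of the removed length \<open>bs ! j\<close> is put
    back at position \<open>j\<close>, between the exponents of the remaining lengths.\<close>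
  define \<delta> where "\<delta> = (\<lambda>(\<beta>, k). (2 * hd \<beta> + 2 - k) # merge {j} (length ds) [k] (double (tl \<beta>)))"
  have fin: "finite S" by (simp add: S_def)
  have *: "has_coefficient ?n (2 * (3 * g - 3 + int ?n))
    (\<lambda>b bs. (LBINT x=ereal 0..ereal (b + bs ! j). of_real x * V g (of_real x # nths (map complex_of_real bs) (- {j})))
      + (LBINT x=ereal 0..ereal (b - bs ! j). of_real x * V g (of_real x # nths (map complex_of_real bs) (- {j}))))
    (double (d # ds)) (\<Sum>s\<in>S. if \<delta> s = double (d # ds) then a s else 0)"
  proof (rule has_coefficient_sum_monom[OF fin])
    fix s assume "s \<in> S"
    then obtain h \<beta> k where "s = (h # \<beta>, k)" "length \<beta> = length ?ds" "k \<le> 2 * h + 2"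
      "int (h + sum_list \<beta>) \<le> 3 * g - 3 + int (Suc (length ?ds))"
      by (auto simp: S_def bounded_lists_def length_Suc_conv)
    then show "length (\<delta> s) = ?n \<and> int (sum_list (\<delta> s)) \<le> 2 * (3 * g - 3 + int ?n)"
      using length_ds sum_list_merge[of "[k]" ds "{j}" "double \<beta>"]
      by (simp add: \<delta>_def single del: merge.simps)
  next
    fix b :: real and bs :: "real list" assume len: "length (b # bs) = ?n"
    let ?b = "complex_of_real b" and ?bs = "map complex_of_real bs" and ?y = "complex_of_real (bs ! j)"
    let ?m = "\<lambda>\<beta>. monom_eval (double (tl \<beta>)) (nths ?bs (- {j}))"
    have lens: "length (nths ?bs J) = length (nths ds J)" for J
      using len by (intro length_nths_eq) simp
    have single_bs: "nths ?bs {j} = [?y]" using j len by (subst nths_singleton) auto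
    have m: "?y ^ k * ?m \<beta> = monom_eval (merge {j} (length ds) [k] (double (tl \<beta>))) ?bs"
      if "\<beta> \<in> exponents g (Suc (length ?ds))" for \<beta> k
    proof -
      have "monom_eval (merge {j} (length ?bs) [k] (double (tl \<beta>))) ?bs
          = monom_eval [k] (nths ?bs {j}) * ?m \<beta>"
        using that by (intro monom_eval_merge) (auto simp: bounded_lists_def lens single)
      then show ?thesis using len by (simp add: single_bs)
    qed
    have "of_real x * V g (of_real x # nths ?bs (- {j}))
        = (\<Sum>\<beta>\<in>exponents g (Suc (length ?ds)). (c g \<beta> * ?m \<beta>) * of_real x ^ (2 * hd \<beta> + 1))" for x
      unfolding expansion_Cons lens sum_distrib_left by (intro sum.cong) (auto simp: mult_ac)
    then have int: "(LBINT x=ereal 0..ereal B. of_real x * V g (of_real x # nths ?bs (- {j})))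
        = (\<Sum>\<beta>\<in>exponents g (Suc (length ?ds)).
            c g \<beta> * ?m \<beta> / of_nat (2 * hd \<beta> + 2) * of_real B ^ (2 * hd \<beta> + 2))" for B
      using interval_integral_sum_monom[of B "\<lambda>\<beta>. c g \<beta> * ?m \<beta>" "\<lambda>\<beta>. 2 * hd \<beta> + 1"] by simp
    have "(LBINT x=ereal 0..ereal (b + bs ! j). of_real x * V g (of_real x # nths ?bs (- {j})))
      + (LBINT x=ereal 0..ereal (b - bs ! j). of_real x * V g (of_real x # nths ?bs (- {j})))
      = (\<Sum>\<beta>\<in>exponents g (Suc (length ?ds)). c g \<beta> * ?m \<beta> / of_nat (2 * hd \<beta> + 2)
          * ((?b + ?y) ^ (2 * hd \<beta> + 2) + (?b - ?y) ^ (2 * hd \<beta> + 2)))"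
      unfolding int sum.distrib[symmetric] distrib_left by simp
    also have "\<dots> = (\<Sum>\<beta>\<in>exponents g (Suc (length ?ds)). \<Sum>k\<le>2 * hd \<beta> + 2.
        a (\<beta>, k) * (?b ^ (2 * hd \<beta> + 2 - k) * (?y ^ k * ?m \<beta>)))"
      unfolding even_binomial_sum sum_distrib_left a_def by (intro sum.cong) (auto simp: mult_ac)
    also have "\<dots> = (\<Sum>s\<in>S. a s * monom_eval (\<delta> s) (map of_real (b # bs)))"
      unfolding S_def by (subst sum.Sigma) (auto simp: m \<delta>_def intro!: sum.cong)
    finally show "(LBINT x=ereal 0..ereal (b + bs ! j). of_real x * V g (of_real x # nths ?bs (- {j})))
      + (LBINT x=ereal 0..ereal (b - bs ! j). of_real x * V g (of_real x # nths ?bs (- {j})))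
      = (\<Sum>s\<in>S. a s * monom_eval (\<delta> s) (map of_real (b # bs)))" .
  qed
  have match: "k = 2 * ds ! j \<and> \<beta> = ?ds \<and> h + 1 = d + ds ! j"
    if "(h # \<beta>, k) \<in> S" "\<delta> (h # \<beta>, k) = double (d # ds)" for h \<beta> k
  proof -
    have len: "length \<beta> = length ?ds" "k \<le> 2 * h + 2"
      using that(1) by (auto simp: S_def bounded_lists_def)
    have "2 * h + 2 - k = 2 * d" "merge {j} (length (double ds)) [k] (double \<beta>) = double ds"
      using that(2) by (auto simp: \<delta>_def)
    then have "2 * h + 2 - k = 2 * d" "k = 2 * ds ! j" "\<beta> = ?ds"
      using len merge_eq_iff[of "[k]" "double ds" "{j}" "double \<beta>"] by (simp_all add: nths_map single)
    then show ?thesis using len(2) by auto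
  qed
  have "(\<Sum>s\<in>S. if \<delta> s = double (d # ds) then a s else 0)
      = (if d + ds ! j = 0 then 0
         else c g ((d + ds ! j - 1) # nths ds (- {j}))
           * of_nat ((2 * (d + ds ! j)) choose (2 * ds ! j)) / of_nat (d + ds ! j))"
  proof (cases "d + ds ! j = 0")
    case True
    \<comment> \<open>The powers of \<open>b\<close> and \<open>bs ! j\<close> have total exponent
      \<open>2 * h + 2 > 0\<close>, so nothing matches when both prescribed exponents
      vanish.\<close>
    have "(if \<delta> s = double (d # ds) then a s else 0) = 0" if s_in: "s \<in> S" for s
    proof -
      obtain h \<beta> k where s: "s = (h # \<beta>, k)"
        using s_in by (auto simp: S_def bounded_lists_def length_Suc_conv)
      show ?thesis using match[of h \<beta> k] s_in True by (auto simp: s)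
    qed
    then have "(\<Sum>s\<in>S. if \<delta> s = double (d # ds) then a s else 0) = 0" by (intro sum.neutral) blast
    then show ?thesis using True by auto
  next
    case False
    define h where "h = d + ds ! j - 1"
    have h: "d + ds ! j = Suc h" using False by (simp add: h_def)
    let ?s = "(h # ?ds, 2 * ds ! j)"
    have "(\<Sum>s\<in>S. if \<delta> s = double (d # ds) then a s else 0)
        = (if \<delta> ?s = double (d # ds) then a ?s else 0)"
    proof (rule sum_eq_single[OF fin])
      have "int (h + sum_list ?ds) \<le> 3 * g - 3 + int (Suc (length ?ds))" "2 * ds ! j \<le> 2 * h + 2"
        using deg length_ds sum_ds h by linarith+
      then show "?s \<in> S" by (simp add: S_def bounded_lists_def)
      fix s assume s: "s \<in> S" "s \<noteq> ?s"
      then obtain h' \<beta> k where s_eq: "s = (h' # \<beta>, k)"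
        by (auto simp: S_def bounded_lists_def length_Suc_conv)
      have "\<delta> s \<noteq> double (d # ds)"
      proof
        assume "\<delta> s = double (d # ds)"
        then have "k = 2 * ds ! j" "\<beta> = ?ds" "h' + 1 = d + ds ! j"
          using match s(1) unfolding s_eq by blast+
        then show False using s(2) h unfolding s_eq by simp
      qed
      then show "(if \<delta> s = double (d # ds) then a s else 0) = 0" by simp
    qed
    moreover have "\<delta> ?s = double (d # ds)"
    proof -
      have "2 * h + 2 - 2 * ds ! j = 2 * d" using h by simp
      moreover have "merge {j} (length ds) [2 * ds ! j] (double ?ds) = double ds"
        using merge_nths[of "{j}" "double ds"] by (simp add: nths_map single)
      ultimately show ?thesis by (simp add: \<delta>_def)
    qed
    moreover have "a ?s = c g (h # ?ds) * of_nat ((2 * Suc h) choose (2 * ds ! j)) / of_nat (Suc h)"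
    proof -
      have e: "of_nat (2 * Suc h) = 2 * (of_nat (Suc h) :: complex)" "2 * h + 2 = 2 * Suc h" by simp_all
      have "a ?s = c g (h # ?ds) / of_nat (2 * h + 2) * (of_nat ((2 * h + 2) choose (2 * ds ! j)) * 2)"
        by (simp add: a_def)
      also have "\<dots> = c g (h # ?ds) / (2 * of_nat (Suc h)) * (of_nat ((2 * Suc h) choose (2 * ds ! j)) * 2)"
        by (simp only: e)
      also have "\<dots> = c g (h # ?ds) * of_nat ((2 * Suc h) choose (2 * ds ! j)) / of_nat (Suc h)"
        by (simp del: of_nat_Suc mult_Suc_right)
      finally show ?thesis .
    qed
    ultimately show ?thesis using False h by simp
  qed
  with * show ?thesis by simp
qed

text \<open>Linearity suffices, because the three kinds of terms were bounded by the same
  degree.\<close>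

lemma has_coefficient_rhs:
  assumes deg: "int (d + sum_list ds) = 3 * g - 3 + int (Suc (length ds))"
  shows "has_coefficient (Suc (length ds)) (2 * (3 * g - 3 + int (Suc (length ds))))
    (recursion_rhs V g) (double (d # ds))
    (1 / 2 * (\<Sum>(\<mu>, \<nu>) | \<mu> + \<nu> + 2 = d. c (g - 1) (\<mu> # \<nu> # ds) * triangle_coeff \<mu> \<nu>)
     + 1 / 2 * (\<Sum>p \<in> {(g1, g2). 0 \<le> g1 \<and> 0 \<le> g2 \<and> g1 + g2 = g}. \<Sum>I \<in> Pow {..<length ds}.
         let \<mu> = 3 * fst p - 3 + int (Suc (length (nths ds I))) - int (sum_list (nths ds I));
             \<nu> = 3 * snd p - 3 + int (Suc (length (nths ds (- I)))) - int (sum_list (nths ds (- I)))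
         in if 0 \<le> \<mu> \<and> 0 \<le> \<nu>
            then c (fst p) (nat \<mu> # nths ds I) * c (snd p) (nat \<nu> # nths ds (- I)) * triangle_coeff (nat \<mu>) (nat \<nu>)
            else 0)
     + 1 / 2 * (\<Sum>j<length ds.
         if d + ds ! j = 0 then 0
         else c g ((d + ds ! j - 1) # nths ds (- {j}))
           * of_nat ((2 * (d + ds ! j)) choose (2 * ds ! j)) / of_nat (d + ds ! j)))"
    (is "has_coefficient ?n ?D _ ?\<alpha> (1 / 2 * ?c1 + 1 / 2 * (\<Sum>p\<in>?G. \<Sum>I\<in>?P. ?c2 p I) + 1 / 2 * (\<Sum>j<length ds. ?c3 j))")
proof -
  define T1 where "T1 = (\<lambda>b bs. LINT p:triangle b|lborel. of_real (fst p) * of_real (snd p)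
       * V (g - 1) (of_real (fst p) # of_real (snd p) # map complex_of_real bs))"
  define T2 where "T2 = (\<lambda>q I b bs. LINT p:triangle b|lborel. of_real (fst p) * of_real (snd p)
       * V (fst q) (of_real (fst p) # nths (map complex_of_real bs) I)
       * V (snd q) (of_real (snd p) # nths (map complex_of_real bs) (- I)))"
  define T3 where "T3 = (\<lambda>j b bs.
      (LBINT x=ereal 0..ereal (b + bs ! j). of_real x * V g (of_real x # nths (map complex_of_real bs) (- {j})))
      + (LBINT x=ereal 0..ereal (b - bs ! j). of_real x * V g (of_real x # nths (map complex_of_real bs) (- {j}))))"
  have "has_coefficient ?n ?D T1 ?\<alpha> ?c1"
    unfolding T1_def by (rule has_coefficient_nonseparating[OF deg])
  moreover have "has_coefficient ?n ?D (T2 p I) ?\<alpha> (?c2 p I)" if "p \<in> ?G" for p I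
  proof -
    have g: "fst p + snd p = g" using that by auto
    show ?thesis
      using has_coefficient_separating[of d ds "fst p" "snd p" I] deg unfolding T2_def Let_def g by blast
  qed
  moreover have "has_coefficient ?n ?D (T3 j) ?\<alpha> (?c3 j)" if "j < length ds" for j
    unfolding T3_def by (rule has_coefficient_boundary[OF deg that])
  ultimately have "has_coefficient ?n ?D
      (\<lambda>b bs. 1 / 2 * T1 b bs + 1 / 2 * (\<Sum>p\<in>?G. \<Sum>I\<in>?P. T2 p I b bs) + 1 / 2 * (\<Sum>j<length ds. T3 j b bs)) ?\<alpha>
      (1 / 2 * ?c1 + 1 / 2 * (\<Sum>p\<in>?G. \<Sum>I\<in>?P. ?c2 p I) + 1 / 2 * (\<Sum>j<length ds. ?c3 j))"
    by (intro has_coefficient_add has_coefficient_cmult has_coefficient_sum) auto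
  then show ?thesis
  proof (rule has_coefficient_cong)
    fix b :: real and bs :: "real list" assume "length (b # bs) = ?n"
    then show "recursion_rhs V g b bs
      = 1 / 2 * T1 b bs + 1 / 2 * (\<Sum>p\<in>?G. \<Sum>I\<in>?P. T2 p I b bs) + 1 / 2 * (\<Sum>j<length ds. T3 j b bs)"
      by (simp add: recursion_rhs_def Let_def T1_def T2_def T3_def triangle_def case_prod_beta)
  qed
qed

end

section \<open>Intersection numbers\<close>

lemma of_nat_double_fact_odd:
  "of_nat (double_fact (2 * int k + 1)) * (2 ^ k * fact k) = (fact (2 * k + 1) :: complex)"
  using arg_cong[OF double_fact_odd[of k], of "of_nat :: nat \<Rightarrow> complex"]
  by (simp only: of_nat_mult of_nat_power of_nat_fact of_nat_numeral)

lemma of_nat_double_fact_even_pred: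
  "of_nat (double_fact (2 * int k - 1)) * (2 ^ k * fact k) = (fact (2 * k) :: complex)"
  using arg_cong[OF double_fact_even_pred[of k], of "of_nat :: nat \<Rightarrow> complex"]
  by (simp only: of_nat_mult of_nat_power of_nat_fact of_nat_numeral)

lemma triangle_coeff_eq:
  "triangle_coeff \<mu> \<nu>
    = of_nat (double_fact (2 * int \<mu> + 1)) * of_nat (double_fact (2 * int \<nu> + 1))
      * ((2 ^ \<mu> * fact \<mu>) * (2 ^ \<nu> * fact \<nu>)) / fact (2 * (\<mu> + \<nu> + 2))"
  unfolding triangle_coeff_def of_nat_double_fact_odd[symmetric] by (simp add: mult_ac)

lemma even_fact_prod_Cons: "even_fact_prod (k # \<beta>) = (2 ^ k * fact k) * even_fact_prod \<beta>"
  by (simp add: even_fact_prod_def)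

lemma even_fact_prod_conv_double_fact:
  "even_fact_prod \<beta> = (\<Prod>k\<leftarrow>map int \<beta>. of_nat (double_fact (2 * k)))"
  by (simp add: even_fact_prod_def double_fact_even comp_def)

lemma even_fact_prod_nths:
  "even_fact_prod \<beta> = even_fact_prod (nths \<beta> I) * even_fact_prod (nths \<beta> (- I))"
  unfolding even_fact_prod_def by (rule prod_list_nths_Compl)

lemma sum_list_map_int: "sum_list (map int xs) = int (sum_list xs)"
  by (induction xs) auto

section \<open>From coefficients to brackets over a common denominator\<close>

context moduli_cohomology
begin

abbreviation bracket :: "int \<Rightarrow> int list \<Rightarrow> complex" where
  "bracket \<equiv> intersection_number psi integ"

abbreviation odd_double_fact :: "int \<Rightarrow> complex" where
  "odd_double_fact k \<equiv> of_nat (double_fact (2 * k + 1))"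

lemma bracket_neg: "\<mu> < 0 \<Longrightarrow> bracket g (\<mu> # ds) = 0"
  by (simp add: intersection_number_def Let_def)

lemma volume_coeff_lhs:
  assumes "int (d + sum_list ds) = 3 * g - 3 + int (Suc (length ds))"
  shows "of_nat (2 * d + 1) * volume_coeff g (d # ds)
    = odd_double_fact (int d) * bracket g (map int (d # ds)) / (fact (2 * d) * even_fact_prod ds)"
proof -
  have "of_nat (2 * d + 1) * fact (2 * d) = (fact (2 * d + 1) :: complex)"
    by simp
  also have "\<dots> = odd_double_fact (int d) * (2 ^ d * fact d)"
    by (rule of_nat_double_fact_odd[symmetric])
  finally have "of_nat (2 * d + 1) = odd_double_fact (int d) * (2 ^ d * fact d) / fact (2 * d)"
    by (simp add: field_simps)
  then show ?thesis
    using assms by (subst volume_coeff_top) (simp_all add: even_fact_prod_Cons)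
qed

text \<open>The factors (2\<mu>)!! and (2\<nu>)!! of the top coefficient cancel against the triangle
  constant, whose denominator is exactly \<open>(2 * d)!\<close>.\<close>

lemma volume_coeff_nonseparating:
  assumes deg: "int (d + sum_list ds) = 3 * g - 3 + int (Suc (length ds))"
  shows "(\<Sum>(\<mu>, \<nu>) | \<mu> + \<nu> + 2 = d. volume_coeff (g - 1) (\<mu> # \<nu> # ds) * triangle_coeff \<mu> \<nu>)
    = (\<Sum>(\<mu>, \<nu>) \<in> {(\<mu>, \<nu>). 0 \<le> \<mu> \<and> 0 \<le> \<nu> \<and> \<mu> + \<nu> = int d - 2}.
         odd_double_fact \<mu> * odd_double_fact \<nu> * bracket (g - 1) (\<mu> # \<nu> # map int ds))
      / (fact (2 * d) * even_fact_prod ds)"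
  unfolding sum_divide_distrib
proof (rule sum.reindex_bij_witness[where i = "\<lambda>(\<mu>, \<nu>). (nat \<mu>, nat \<nu>)" and j = "\<lambda>(\<mu>, \<nu>). (int \<mu>, int \<nu>)"])
  fix p :: "nat \<times> nat" assume "p \<in> {(\<mu>, \<nu>). \<mu> + \<nu> + 2 = d}"
  then obtain \<mu> \<nu> where p: "p = (\<mu>, \<nu>)" and d: "\<mu> + \<nu> + 2 = d" by auto
  have "int (sum_list (\<mu> # \<nu> # ds)) = 3 * (g - 1) - 3 + int (length (\<mu> # \<nu> # ds))"
    using deg d by simp
  then show "(case case p of (\<mu>, \<nu>) \<Rightarrow> (int \<mu>, int \<nu>) of
        (\<mu>, \<nu>) \<Rightarrow> odd_double_fact \<mu> * odd_double_fact \<nu> * bracket (g - 1) (\<mu> # \<nu> # map int ds))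
          / (fact (2 * d) * even_fact_prod ds)
      = (case p of (\<mu>, \<nu>) \<Rightarrow> volume_coeff (g - 1) (\<mu> # \<nu> # ds) * triangle_coeff \<mu> \<nu>)"
    unfolding p by (simp add: volume_coeff_top even_fact_prod_Cons triangle_coeff_eq d[symmetric] mult_ac
        del: fact_Suc mult_Suc_right)
qed auto

lemma volume_coeff_separating:
  fixes g1 g2 :: int and I :: "nat set"
  assumes deg: "int (d + sum_list ds) = 3 * (g1 + g2) - 3 + int (Suc (length ds))"
  defines "\<mu> \<equiv> 3 * g1 - 3 + int (Suc (length (nths ds I))) - int (sum_list (nths ds I))"
    and "\<nu> \<equiv> 3 * g2 - 3 + int (Suc (length (nths ds (- I)))) - int (sum_list (nths ds (- I)))"
  shows "(if 0 \<le> \<mu> \<and> 0 \<le> \<nu>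
      then volume_coeff g1 (nat \<mu> # nths ds I) * volume_coeff g2 (nat \<nu> # nths ds (- I))
        * triangle_coeff (nat \<mu>) (nat \<nu>)
      else 0)
    = odd_double_fact \<mu> * odd_double_fact \<nu>
        * bracket g1 (\<mu> # nths (map int ds) I) * bracket g2 (\<nu> # nths (map int ds) (- I))
      / (fact (2 * d) * even_fact_prod ds)"
proof (cases "0 \<le> \<mu> \<and> 0 \<le> \<nu>")
  case True
  then obtain k l where kl: "\<mu> = int k" "\<nu> = int l" by (metis nonneg_int_cases)
  have "\<mu> + \<nu> + 2 = int d"
    using deg length_nths_Compl[of ds I] sum_list_nths_Compl[of ds I] unfolding \<mu>_def \<nu>_def by simp
  then have d: "d = k + l + 2" using kl by simp
  have "int (sum_list (k # nths ds I)) = 3 * g1 - 3 + int (length (k # nths ds I))"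
    "int (sum_list (l # nths ds (- I))) = 3 * g2 - 3 + int (length (l # nths ds (- I)))"
    using kl unfolding \<mu>_def \<nu>_def by simp_all
  then have "volume_coeff g1 (k # nths ds I) * volume_coeff g2 (l # nths ds (- I)) * triangle_coeff k l
    = odd_double_fact (int k) * odd_double_fact (int l)
        * bracket g1 (int k # nths (map int ds) I) * bracket g2 (int l # nths (map int ds) (- I))
      / (fact (2 * d) * even_fact_prod ds)"
    by (simp add: volume_coeff_top even_fact_prod_Cons even_fact_prod_nths[of ds I] triangle_coeff_eq d nths_map mult_ac
        del: fact_Suc mult_Suc_right)
  then show ?thesis by (simp add: kl)
next
  case False
  \<comment> \<open>The bracket side vanishes as well, as one of its brackets has a negative
    index.\<close>
  then show ?thesis by (auto simp: bracket_neg)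
qed

lemma volume_coeff_boundary:
  assumes deg: "int (d + sum_list ds) = 3 * g - 3 + int (Suc (length ds))" and j: "j < length ds"
  shows "1 / 2 * (if d + ds ! j = 0 then 0
     else volume_coeff g ((d + ds ! j - 1) # nths ds (- {j}))
       * of_nat ((2 * (d + ds ! j)) choose (2 * ds ! j)) / of_nat (d + ds ! j))
   = of_nat (double_fact (2 * int d + 2 * int (ds ! j) - 1)) / of_nat (double_fact (2 * int (ds ! j) - 1))
       * bracket g ((int d + int (ds ! j) - 1) # nths (map int ds) (- {j}))
     / (fact (2 * d) * even_fact_prod ds)"
proof (cases "d + ds ! j = 0")
  case True
  \<comment> \<open>Here the bracket contains the index -1 and is zero by convention.\<close>
  then show ?thesis by (simp add: bracket_neg)
next
  case False
  define h k where "h = d + ds ! j - 1" and "k = ds ! j"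
  have h: "d + k = Suc h" using False by (simp add: h_def k_def)
  have single: "nths ds {j} = [k]" using nths_singleton[OF j] by (simp add: k_def)
  have len: "length ds = Suc (length (nths ds (- {j})))" and sum: "sum_list ds = k + sum_list (nths ds (- {j}))"
    using length_nths_Compl[of ds "{j}"] sum_list_nths_Compl[of ds "{j}"] by (simp_all add: single)
  have W: "even_fact_prod ds = (2 ^ k * fact k) * even_fact_prod (nths ds (- {j}))"
    using even_fact_prod_nths[of ds "{j}"] by (simp add: single even_fact_prod_def)
  have "int (sum_list (h # nths ds (- {j}))) = 3 * g - 3 + int (length (h # nths ds (- {j})))"
    using deg len sum h by simp
  then have top: "volume_coeff g (h # nths ds (- {j}))
      = bracket g (int h # nths (map int ds) (- {j})) / ((2 ^ h * fact h) * even_fact_prod (nths ds (- {j})))"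
    by (subst volume_coeff_top) (simp_all add: even_fact_prod_Cons nths_map)
  define A where "A = odd_double_fact (int h)"
  define B :: complex where "B = of_nat (double_fact (2 * int k - 1))"
  have A: "A * (2 ^ h * fact h) = fact (2 * h + 1)"
    unfolding A_def by (rule of_nat_double_fact_odd)
  have B: "B * (2 ^ k * fact k) = fact (2 * k)"
    unfolding B_def by (rule of_nat_double_fact_even_pred)
  have "B \<noteq> 0" using B by (metis fact_nonzero mult_zero_left)
  have "2 * k \<le> 2 * Suc h" "2 * Suc h - 2 * k = 2 * d" using h by auto
  then have "of_nat ((2 * Suc h) choose (2 * k)) = (fact (2 * Suc h) / (fact (2 * k) * fact (2 * d)) :: complex)"
    using binomial_fact[of "2 * k" "2 * Suc h"] by simp
  also have "fact (2 * Suc h) = (2 * of_nat (Suc h) * (A * (2 ^ h * fact h)) :: complex)"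
    unfolding A by (simp add: algebra_simps)
  \<comment> \<open>With this form (2h)!! cancels against the top coefficient,
    \<open>2 * Suc h\<close> against \<open>1 / 2\<close> and the division by \<open>Suc h\<close>,
    and (2k)!! completes the denominator to \<open>even_fact_prod ds\<close>.\<close>
  finally have binom: "of_nat ((2 * Suc h) choose (2 * k))
      = 2 * of_nat (Suc h) * (A * (2 ^ h * fact h)) / (B * (2 ^ k * fact k) * fact (2 * d))"
    by (simp only: B)
  have "1 / 2 * (volume_coeff g (h # nths ds (- {j})) * of_nat ((2 * Suc h) choose (2 * k)) / of_nat (Suc h))
      = A / B * bracket g (int h # nths (map int ds) (- {j})) / (fact (2 * d) * even_fact_prod ds)"
    unfolding top binom W using \<open>B \<noteq> 0\<close> by (simp add: mult_ac del: of_nat_Suc)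
  then have main: "1 / 2 * (if Suc h = 0 then 0
      else volume_coeff g ((Suc h - 1) # nths ds (- {j})) * of_nat ((2 * Suc h) choose (2 * k)) / of_nat (Suc h))
      = odd_double_fact (int h) / of_nat (double_fact (2 * int k - 1))
        * bracket g (int h # nths (map int ds) (- {j})) / (fact (2 * d) * even_fact_prod ds)"
    unfolding A_def B_def diff_Suc_1 by (simp only: nat.distinct if_False)
  have e: "2 * int d + 2 * int k - 1 = 2 * int h + 1" "int d + int k - 1 = int h"
    using h by linarith+
  show ?thesis unfolding k_def[symmetric] h e by (rule main)
qed

end

theorem theorem5p1:
  fixes smul :: "complex \<Rightarrow> 'h::comm_ring_1 \<Rightarrow> 'h"
    and deg :: "nat \<Rightarrow> 'h set"
    and psi :: "int \<Rightarrow> nat \<Rightarrow> nat \<Rightarrow> 'h"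
    and kappa1 :: "int \<Rightarrow> nat \<Rightarrow> 'h"
    and integ :: "int \<Rightarrow> nat \<Rightarrow> 'h \<Rightarrow> complex"
    and V :: "int \<Rightarrow> complex list \<Rightarrow> complex"
    and g d :: int and n :: nat and ds :: "int list"
  assumes "moduli_cohomology smul deg psi kappa1 integ"
    and "volume_formula smul psi kappa1 integ V"
    and "volume_recursion V g n"
    and "g \<ge> 0" and "n \<ge> 1" and "2 * g - 2 + int n \<ge> 2"
    and "length ds = n - 1"
    and "d \<ge> 0" and "\<forall>x\<in>set ds. x \<ge> 0"
    and "d + sum_list ds = 3 * g - 3 + int n"
  shows
    "let \<tau> = intersection_number psi integ;
         lhs = of_nat (double_fact (2 * d + 1)) * \<tau> g (d # ds);
         rhs =
           1 / 2 * (\<Sum>(\<mu>, \<nu>) \<in> {(\<mu>, \<nu>). 0 \<le> \<mu> \<and> 0 \<le> \<nu> \<and> \<mu> + \<nu> = d - 2}.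
              of_nat (double_fact (2 * \<mu> + 1)) * of_nat (double_fact (2 * \<nu> + 1))
                * \<tau> (g - 1) (\<mu> # \<nu> # ds))
         + 1 / 2 * (\<Sum>(g1, g2) \<in> {(g1, g2). 0 \<le> g1 \<and> 0 \<le> g2 \<and> g1 + g2 = g}.
              \<Sum>I \<in> Pow {..<length ds}.
                let ds1 = nths ds I; ds2 = nths ds (- I);
                    \<mu> = 3 * g1 - 3 + int (length ds1 + 1) - sum_list ds1;
                    \<nu> = 3 * g2 - 3 + int (length ds2 + 1) - sum_list ds2
                in of_nat (double_fact (2 * \<mu> + 1)) * of_nat (double_fact (2 * \<nu> + 1))
                     * \<tau> g1 (\<mu> # ds1) * \<tau> g2 (\<nu> # ds2))
         + (\<Sum>j<length ds.
              of_nat (double_fact (2 * d + 2 * ds ! j - 1)) / of_nat (double_fact (2 * ds ! j - 1))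
                * \<tau> g ((d + ds ! j - 1) # nths ds (- {j})));
         \<alpha> = map (\<lambda>k. 2 * nat k) (d # ds);
         D = 2 * (3 * g - 3 + int n);
         K = fact (2 * nat d) * (\<Prod>k\<leftarrow>ds. of_nat (double_fact (2 * k)))
     in (\<exists>L R. has_coefficients n D (recursion_lhs V g) L
             \<and> has_coefficients n D (recursion_rhs V g) R
             \<and> L \<alpha> = lhs / K \<and> R \<alpha> = rhs / K)
        \<and> lhs = rhs"
proof -
  interpret moduli_cohomology smul deg psi kappa1 integ by fact
  interpret polynomial_volumes V volume_coeff
    by unfold_locales (rule volume_expansion[OF assms(2)])
  define e es where "e = nat d" and "es = map nat ds"
  have d: "d = int e" using assms(8) by (simp add: e_def)
  have ds: "ds = map int es" using assms(9) by (simp add: es_def map_idI)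
  have n: "n = Suc (length es)" using assms(5,7) by (simp add: ds)
  have top: "int (e + sum_list es) = 3 * g - 3 + int (Suc (length es))"
    using assms(10) by (simp add: d ds n sum_list_map_int)
  \<comment> \<open>The common denominator of all terms; being nonzero, it can be cancelled once the
    coefficients agree.\<close>
  define K where "K = fact (2 * e) * even_fact_prod es"
  have K: "K \<noteq> 0" by (simp add: K_def)
  have K_eq: "fact (2 * nat d) * (\<Prod>k\<leftarrow>ds. of_nat (double_fact (2 * k))) = K"
    by (simp add: K_def d ds even_fact_prod_conv_double_fact)
  have \<alpha>_eq: "map (\<lambda>k. 2 * nat k) (d # ds) = double (e # es)"
    by (simp add: d ds comp_def)
  define lhs where "lhs = odd_double_fact d * bracket g (d # ds)"
  define r1 where "r1 = (\<Sum>(\<mu>, \<nu>) \<in> {(\<mu>, \<nu>). 0 \<le> \<mu> \<and> 0 \<le> \<nu> \<and> \<mu> + \<nu> = d - 2}.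
      odd_double_fact \<mu> * odd_double_fact \<nu> * bracket (g - 1) (\<mu> # \<nu> # ds))"
  define r2 where "r2 = (\<Sum>(g1, g2) \<in> {(g1, g2). 0 \<le> g1 \<and> 0 \<le> g2 \<and> g1 + g2 = g}.
      \<Sum>I \<in> Pow {..<length ds}.
        let ds1 = nths ds I; ds2 = nths ds (- I);
            \<mu> = 3 * g1 - 3 + int (length ds1 + 1) - sum_list ds1;
            \<nu> = 3 * g2 - 3 + int (length ds2 + 1) - sum_list ds2
        in odd_double_fact \<mu> * odd_double_fact \<nu> * bracket g1 (\<mu> # ds1) * bracket g2 (\<nu> # ds2))"
  define r3 where "r3 = (\<Sum>j<length ds.
      of_nat (double_fact (2 * d + 2 * ds ! j - 1)) / of_nat (double_fact (2 * ds ! j - 1))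
        * bracket g ((d + ds ! j - 1) # nths ds (- {j})))"
  let ?D = "2 * (3 * g - 3 + int n)"
  obtain L where L: "has_coefficients n ?D (recursion_lhs V g) L" "L (double (e # es)) = lhs / K"
    using has_coefficient_lhs[OF top] volume_coeff_lhs[OF top]
    unfolding has_coefficient_def by (auto simp: n lhs_def K_def d ds)
  have "has_coefficient n ?D (recursion_rhs V g) (double (e # es)) ((1 / 2 * r1 + 1 / 2 * r2 + r3) / K)"
  proof -
    have r1: "(\<Sum>(\<mu>, \<nu>) | \<mu> + \<nu> + 2 = e. volume_coeff (g - 1) (\<mu> # \<nu> # es) * triangle_coeff \<mu> \<nu>) = r1 / K"
      unfolding r1_def K_def d ds by (rule volume_coeff_nonseparating[OF top])
    have r2: "(\<Sum>p \<in> {(g1, g2). 0 \<le> g1 \<and> 0 \<le> g2 \<and> g1 + g2 = g}. \<Sum>I \<in> Pow {..<length es}.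
         let \<mu> = 3 * fst p - 3 + int (Suc (length (nths es I))) - int (sum_list (nths es I));
             \<nu> = 3 * snd p - 3 + int (Suc (length (nths es (- I)))) - int (sum_list (nths es (- I)))
         in if 0 \<le> \<mu> \<and> 0 \<le> \<nu>
            then volume_coeff (fst p) (nat \<mu> # nths es I) * volume_coeff (snd p) (nat \<nu> # nths es (- I))
              * triangle_coeff (nat \<mu>) (nat \<nu>)
            else 0) = r2 / K"
      unfolding r2_def sum_divide_distrib case_prod_beta
    proof (intro sum.cong refl)
      fix p :: "int \<times> int" and I assume "p \<in> {p. 0 \<le> fst p \<and> 0 \<le> snd p \<and> fst p + snd p = g}"
      then have "int (e + sum_list es) = 3 * (fst p + snd p) - 3 + int (Suc (length es))"
        using top by simp
      from volume_coeff_separating[OF this, of I]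
      show "(let \<mu> = 3 * fst p - 3 + int (Suc (length (nths es I))) - int (sum_list (nths es I));
             \<nu> = 3 * snd p - 3 + int (Suc (length (nths es (- I)))) - int (sum_list (nths es (- I)))
         in if 0 \<le> \<mu> \<and> 0 \<le> \<nu>
            then volume_coeff (fst p) (nat \<mu> # nths es I) * volume_coeff (snd p) (nat \<nu> # nths es (- I))
              * triangle_coeff (nat \<mu>) (nat \<nu>)
            else 0)
        = (let ds1 = nths ds I; ds2 = nths ds (- I);
            \<mu> = 3 * fst p - 3 + int (length ds1 + 1) - sum_list ds1;
            \<nu> = 3 * snd p - 3 + int (length ds2 + 1) - sum_list ds2
        in odd_double_fact \<mu> * odd_double_fact \<nu> * bracket (fst p) (\<mu> # ds1) * bracket (snd p) (\<nu> # ds2)) / K"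
        unfolding Let_def K_def ds nths_map length_map sum_list_map_int Suc_eq_plus1 .
    qed (simp add: ds)
    have r3: "1 / 2 * (\<Sum>j<length es.
         if e + es ! j = 0 then 0
         else volume_coeff g ((e + es ! j - 1) # nths es (- {j}))
           * of_nat ((2 * (e + es ! j)) choose (2 * es ! j)) / of_nat (e + es ! j)) = r3 / K"
      unfolding r3_def sum_divide_distrib sum_distrib_left
    proof (rule sum.cong)
      fix j assume "j \<in> {..<length ds}"
      then have j: "j < length es" by (simp add: ds)
      show "1 / 2 * (if e + es ! j = 0 then 0
         else volume_coeff g ((e + es ! j - 1) # nths es (- {j}))
           * of_nat ((2 * (e + es ! j)) choose (2 * es ! j)) / of_nat (e + es ! j))
        = of_nat (double_fact (2 * d + 2 * ds ! j - 1)) / of_nat (double_fact (2 * ds ! j - 1))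
        * bracket g ((d + ds ! j - 1) # nths ds (- {j})) / K"
        using volume_coeff_boundary[OF top j] unfolding K_def d ds nth_map[OF j] .
    qed (simp add: ds)
    show ?thesis
      using has_coefficient_rhs[OF top] unfolding r1 r2 r3 n[symmetric]
      by (simp add: add_divide_distrib)
  qed
  then obtain R where R: "has_coefficients n ?D (recursion_rhs V g) R"
      "R (double (e # es)) = (1 / 2 * r1 + 1 / 2 * r2 + r3) / K"
    unfolding has_coefficient_def by blast
  \<comment> \<open>The recursion is assumed exactly on the orthant, where values determine the
    coefficient functions.\<close>
  have "L = R"
  proof (rule has_coefficients_unique[OF L(1) R(1) assms(5)])
    fix b :: real and bs :: "real list" assume "length (b # bs) = n" "\<forall>x\<in>set (b # bs). 0 \<le> x"
    then show "recursion_lhs V g b bs = recursion_rhs V g b bs"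
      using assms(3) by (auto simp: volume_recursion_def)
  qed
  then have "lhs = 1 / 2 * r1 + 1 / 2 * r2 + r3"
    using L(2) R(2) K by simp
  then show ?thesis
    using L R unfolding Let_def K_eq \<alpha>_eq lhs_def r1_def r2_def r3_def by blast
qed

end
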